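(* Let $\mathcal H$ be an infinite-dimensional complex Hilbert space with inner product $\langle\cdot,\cdot\rangle$ (conjugate-linear in the first, linear in the second argument), and let $\mathcal D\subset\mathcal H$ be a dense linear subspace such that $(\mathcal D,t)$ is an (F)-space, where $t$ is the graph topology defined below. Let $\mathcal F(\mathcal D)$ be the set of finite-rank operators in $\mathcal L^+(\mathcal D)$, i.e. the linear span of the operators $\phi\otimes\psi$, $\phi,\psi\in\mathcal D$, where $(\phi\otimes\psi)\chi=\langle\psi,\chi\rangle\phi$ for $\chi\in\mathcal D$. Suppose that $\Phi\colon\mathcal F(\mathcal D)\to\mathcal F(\mathcal D)$ is an additive surjective mapping preserving projections of rank one and their linear spans, i.e. for every rank-one projection $P\in\mathcal F(\mathcal D)$, $\Phi(P)$ is a rank-one projection and $\Phi(\mathbb C P)\subset\mathbb C\,\Phi(P)$. Then one of the following holds: (i) $\Phi(T)=ATA^{-1}$ for all $T\in\mathcal F(\mathcal D)$, where $A\colon\mathcal D\to\mathcal D$ is a bijective operator which is either linear or conjugate-linear; or (ii) $\Phi(T)=CT^+C^{-1}$ for all $T\in\mathcal F(\mathcal D)$, where $C\colon\mathcal D\to\mathcal D$ is a bijective operator which is either linear or conjugate-linear. Moreover, if the operator $A$ (resp. $C$) is linear, then it belongs to $\mathcal L^+(\mathcal D)$.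
   Context: $\mathcal L^+(\mathcal D)$ denotes the *-algebra of all linear operators $A$ (defined on $\mathcal D$) with $A\mathcal D\subset\mathcal D$ and $A^*\mathcal D\subset\mathcal D$ (in particular $\mathcal D\subset\mathcal D(A^* )$), with involution $A\mapsto A^+:=A^*|_{\mathcal D}$. The graph topology $t$ on $\mathcal D$ is the locally convex topology generated by the seminorms $\phi\mapsto\|A\phi\|$, $A\in\mathcal L^+(\mathcal D)$. A projection means an idempotent operator ($P^2=P$); a rank-one projection in $\mathcal F(\mathcal D)$ is thus an operator $\phi\otimes\psi$ with $\langle\psi,\phi\rangle=1$. For $T\in\mathcal F(\mathcal D)$, $T^+=T^*|_{\mathcal D}$. *)

theory Defs
  imports "HOL-Analysis.Analysis"
begin

class cvec = ab_group_add +
  fixes scaleC :: "complex \<Rightarrow> 'a \<Rightarrow> 'a" (infixr \<open>*\<^sub>C\<close> 75)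
  assumes scaleC_add_right: "a *\<^sub>C (x + y) = a *\<^sub>C x + a *\<^sub>C y"
    and scaleC_add_left: "(a + b) *\<^sub>C x = a *\<^sub>C x + b *\<^sub>C x"
    and scaleC_scaleC: "a *\<^sub>C (b *\<^sub>C x) = (a * b) *\<^sub>C x"
    and scaleC_one: "1 *\<^sub>C x = x"

class cinner_space = cvec +
  fixes cinner :: "'a \<Rightarrow> 'a \<Rightarrow> complex"
  assumes cinner_add_right: "cinner x (y + z) = cinner x y + cinner x z"
    and cinner_scaleC_right: "cinner x (a *\<^sub>C y) = a * cinner x y"
    and cinner_conj_sym: "cinner y x = cnj (cinner x y)"
    and cinner_pos: "0 \<le> Re (cinner x x)"
    and cinner_zero: "cinner x x = 0 \<Longrightarrow> x = 0"

definition hnorm :: "'a::cinner_space \<Rightarrow> real" where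
  "hnorm x = sqrt (Re (cinner x x))"

class chilbert = cinner_space +
  assumes chilbert_complete:
    "(\<forall>e>0. \<exists>N. \<forall>m\<ge>N. \<forall>n\<ge>N. sqrt (Re (cinner (X m - X n) (X m - X n))) < e)
       \<Longrightarrow> \<exists>L. (\<lambda>n. sqrt (Re (cinner (X n - L) (X n - L)))) \<longlonglongrightarrow> 0"

definition cspan :: "'a::cvec set \<Rightarrow> 'a set" where
  "cspan S = {x. \<exists>xs :: (complex \<times> 'a) list. set (map snd xs) \<subseteq> S \<and>
                  x = sum_list (map (\<lambda>(c, s). c *\<^sub>C s) xs)}"

definition infinite_dimensional :: "'a::cvec itself \<Rightarrow> bool" where
  "infinite_dimensional _ \<longleftrightarrow> \<not> (\<exists>S :: 'a set. finite S \<and> cspan S = UNIV)"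

definition dense_subspace :: "'a::chilbert set \<Rightarrow> bool" where
  "dense_subspace D \<longleftrightarrow> 0 \<in> D \<and> (\<forall>x\<in>D. \<forall>y\<in>D. x + y \<in> D) \<and> (\<forall>c. \<forall>x\<in>D. c *\<^sub>C x \<in> D)
     \<and> (\<forall>x. \<forall>e>0. \<exists>y\<in>D. hnorm (x - y) < e)"

definition clinear_on :: "'a::cvec set \<Rightarrow> ('a \<Rightarrow> 'a) \<Rightarrow> bool" where
  "clinear_on D A \<longleftrightarrow> (\<forall>x\<in>D. \<forall>y\<in>D. A (x + y) = A x + A y) \<and> (\<forall>c. \<forall>x\<in>D. A (c *\<^sub>C x) = c *\<^sub>C A x)"

definition antilinear_on :: "'a::cvec set \<Rightarrow> ('a \<Rightarrow> 'a) \<Rightarrow> bool" where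
  "antilinear_on D A \<longleftrightarrow> (\<forall>x\<in>D. \<forall>y\<in>D. A (x + y) = A x + A y) \<and> (\<forall>c. \<forall>x\<in>D. A (c *\<^sub>C x) = cnj c *\<^sub>C A x)"

text \<open>\<open>L\<^sup>+(D)\<close>: linear operators on D with \<open>A D \<subseteq> D\<close>, \<open>D \<subseteq> dom(A\<^sup>*)\<close> and \<open>A\<^sup>* D \<subseteq> D\<close>.
  Operators are functions; only their values on D matter.\<close>
definition Lplus :: "'a::chilbert set \<Rightarrow> ('a \<Rightarrow> 'a) \<Rightarrow> bool" where
  "Lplus D A \<longleftrightarrow> clinear_on D A \<and> A ` D \<subseteq> D \<and>
     (\<forall>x\<in>D. \<exists>z\<in>D. \<forall>y\<in>D. cinner z y = cinner x (A y))"

text \<open>\<open>T\<^sup>+ = T\<^sup>*|D\<close> (well defined by density of D).\<close>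
definition adjp :: "'a::chilbert set \<Rightarrow> ('a \<Rightarrow> 'a) \<Rightarrow> 'a \<Rightarrow> 'a" where
  "adjp D T x = (THE z. z \<in> D \<and> (\<forall>y\<in>D. cinner z y = cinner x (T y)))"

text \<open>Graph topology t: generated by seminorms \<open>\<phi> \<mapsto> \<parallel>A\<phi>\<parallel>\<close>, \<open>A \<in> L\<^sup>+(D)\<close>.
  (D,t) is an (F)-space: metrizable (the topology is generated by a countable
  subfamily of the seminorms) and complete (sequentially, equivalent for metrizable spaces).\<close>
definition graph_metrizable :: "'a::chilbert set \<Rightarrow> bool" where
  "graph_metrizable D \<longleftrightarrow> (\<exists>B :: nat \<Rightarrow> 'a \<Rightarrow> 'a. (\<forall>k. Lplus D (B k)) \<and>
     (\<forall>A. Lplus D A \<longrightarrow> (\<exists>k C. \<forall>x\<in>D. hnorm (A x) \<le> C * Max {hnorm (B j x) | j. j \<le> k})))"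

definition graph_complete :: "'a::chilbert set \<Rightarrow> bool" where
  "graph_complete D \<longleftrightarrow> (\<forall>X :: nat \<Rightarrow> 'a. (\<forall>n. X n \<in> D) \<longrightarrow>
     (\<forall>A. Lplus D A \<longrightarrow> (\<forall>e>0. \<exists>N. \<forall>m\<ge>N. \<forall>n\<ge>N. hnorm (A (X m - X n)) < e)) \<longrightarrow>
     (\<exists>x\<in>D. \<forall>A. Lplus D A \<longrightarrow> (\<lambda>n. hnorm (A (X n - x))) \<longlonglongrightarrow> 0))"

definition graph_F_space :: "'a::chilbert set \<Rightarrow> bool" where
  "graph_F_space D \<longleftrightarrow> graph_metrizable D \<and> graph_complete D"

text \<open>Elements of \<open>\<F>(D)\<close> are represented canonically as functions vanishing off D.\<close>
definition tensor :: "'a::chilbert set \<Rightarrow> 'a \<Rightarrow> 'a \<Rightarrow> 'a \<Rightarrow> 'a" where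
  "tensor D \<phi> \<psi> = (\<lambda>\<xi>. if \<xi> \<in> D then cinner \<psi> \<xi> *\<^sub>C \<phi> else 0)"

definition finrank :: "'a::chilbert set \<Rightarrow> ('a \<Rightarrow> 'a) set" where
  "finrank D = {T. \<exists>xs :: ('a \<times> 'a) list. set xs \<subseteq> D \<times> D \<and>
      T = (\<lambda>\<xi>. if \<xi> \<in> D then sum_list (map (\<lambda>(\<phi>, \<psi>). cinner \<psi> \<xi> *\<^sub>C \<phi>) xs) else 0)}"

definition rank_one_proj :: "'a::chilbert set \<Rightarrow> ('a \<Rightarrow> 'a) \<Rightarrow> bool" where
  "rank_one_proj D P \<longleftrightarrow> (\<exists>\<phi>\<in>D. \<exists>\<psi>\<in>D. cinner \<psi> \<phi> = 1 \<and> P = tensor D \<phi> \<psi>)"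

definition opscale :: "complex \<Rightarrow> ('a::cvec \<Rightarrow> 'a) \<Rightarrow> 'a \<Rightarrow> 'a" where
  "opscale c T = (\<lambda>x. c *\<^sub>C T x)"

end

theory Submission
  imports Defs
begin

text \<open>
  For fixed \<open>f\<close>, \<open>\<Phi>\<close> maps all \<open>x \<otimes> f\<close> either to operators with a common functional \<open>g\<close> or to
  operators with a common range: the sum of the idempotents \<open>(u + x) \<otimes> f\<close> and \<open>(u - x) \<otimes> f\<close> is
  \<open>2 u \<otimes> f\<close>, whose image has rank one. Surjectivity forces a uniform alternative, so that, after
  replacing \<open>\<Phi>(T)\<close> by \<open>\<Phi>(T\<^sup>+)\<close> if necessary, \<open>\<Phi>(x \<otimes> f) = A x \<otimes> B f\<close>. Here \<open>A\<close> is semilinear along a ring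
  homomorphism \<open>\<tau>\<close> of the complex numbers, \<open>\<langle>B f, A x\<rangle> = \<tau>\<langle>f, x\<rangle>\<close> and \<open>\<Phi>(T) A = A T\<close>. If \<open>\<tau>\<close> were unbounded near
  \<open>0\<close>, completeness would give some \<open>x\<close> in \<open>D\<close> whose coefficients \<open>c\<^sub>n\<close> along an orthonormal
  sequence \<open>e\<^sub>n\<close> are so small that the series converges while \<open>\<tau> c\<^sub>n = \<langle>B e\<^sub>n, A x\<rangle>\<close> outgrows
  \<open>\<parallel>B e\<^sub>n\<parallel> \<parallel>A x\<parallel>\<close>. So \<open>\<tau>\<close> is the identity or complex conjugation.
\<close>

section \<open>Inner product spaces\<close>

global_interpretation cvec: vector_space "scaleC :: complex \<Rightarrow> 'a \<Rightarrow> 'a::cvec"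
  by standard (simp_all add: scaleC_add_right scaleC_add_left scaleC_scaleC scaleC_one)

lemma cinner_add_left: "cinner (x + y) z = cinner x z + cinner (y::'a::cinner_space) z"
  by (metis cinner_add_right cinner_conj_sym complex_cnj_add)

lemma cinner_scaleC_left: "cinner (c *\<^sub>C x) z = cnj c * cinner (x::'a::cinner_space) z"
  by (metis cinner_scaleC_right cinner_conj_sym complex_cnj_mult)

lemma cinner_zero_right [simp]: "cinner (x::'a::cinner_space) 0 = 0"
  using cinner_add_right[of x 0 0] by simp

lemma cinner_zero_left [simp]: "cinner 0 (x::'a::cinner_space) = 0"
  using cinner_add_left[of 0 0 x] by simp

lemma cinner_minus_right: "cinner (x::'a::cinner_space) (- y) = - cinner x y"
  using cinner_add_right[of x y "- y"] by (simp add: eq_neg_iff_add_eq_0 add.commute)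

lemma cinner_minus_left: "cinner (- x) (y::'a::cinner_space) = - cinner x y"
  using cinner_add_left[of x "- x" y] by (simp add: eq_neg_iff_add_eq_0 add.commute)

lemma cinner_diff_right: "cinner (x::'a::cinner_space) (y - z) = cinner x y - cinner x z"
  using cinner_add_right[of x y "- z"] by (simp add: cinner_minus_right)

lemma cinner_diff_left: "cinner (x - y) (z::'a::cinner_space) = cinner x z - cinner y z"
  using cinner_add_left[of x "- y" z] by (simp add: cinner_minus_left)

lemma cinner_sum_right: "cinner (x::'a::cinner_space) (sum g S) = (\<Sum>i\<in>S. cinner x (g i))"
  by (induction S rule: infinite_finite_induct) (simp_all add: cinner_add_right)

lemma cinner_eq_0_iff [simp]: "cinner x x = 0 \<longleftrightarrow> (x::'a::cinner_space) = 0"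
  using cinner_zero by auto

lemmas cinner_simps = cinner_add_left cinner_add_right cinner_diff_left cinner_diff_right
  cinner_scaleC_left cinner_scaleC_right

lemma cinner_self: "cinner x x = complex_of_real ((hnorm (x::'a::cinner_space))\<^sup>2)"
proof -
  have "Im (cinner x x) = 0"
    using arg_cong[OF cinner_conj_sym[of x x], of Im] by simp
  then show ?thesis
    by (simp add: hnorm_def complex_eq_iff cinner_pos)
qed

lemma hnorm_nonneg [simp]: "0 \<le> hnorm (x::'a::cinner_space)"
  by (simp add: hnorm_def cinner_pos)

lemma hnorm_square: "(hnorm x)\<^sup>2 = Re (cinner x (x::'a::cinner_space))"
  by (simp add: hnorm_def cinner_pos)

lemma hnorm_eq_0_iff [simp]: "hnorm x = 0 \<longleftrightarrow> (x::'a::cinner_space) = 0"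
  by (metis cinner_eq_0_iff cinner_self of_real_eq_0_iff power_eq_0_iff zero_neq_numeral)

lemma hnorm_zero [simp]: "hnorm (0::'a::cinner_space) = 0"
  by simp

lemma hnorm_scaleC: "hnorm (c *\<^sub>C x) = cmod c * hnorm (x::'a::cinner_space)"
proof -
  have "cinner (c *\<^sub>C x) (c *\<^sub>C x) = (c * cnj c) * cinner x x"
    by (simp add: cinner_simps)
  also have "\<dots> = complex_of_real ((cmod c * hnorm x)\<^sup>2)"
    by (simp only: cinner_self power_mult_distrib of_real_mult complex_norm_square)
  finally have "cinner (c *\<^sub>C x) (c *\<^sub>C x) = complex_of_real ((cmod c * hnorm x)\<^sup>2)" .
  then have "(hnorm (c *\<^sub>C x))\<^sup>2 = (cmod c * hnorm x)\<^sup>2"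
    by (simp only: cinner_self of_real_eq_iff)
  then show ?thesis by simp
qed

lemma cinner_Cauchy_Schwarz: "cmod (cinner x y) \<le> hnorm x * hnorm (y::'a::cinner_space)"
proof (cases "x = 0")
  case False
  then have pos: "0 < (hnorm x)\<^sup>2" by (simp add: less_le)
  define c where "c = cinner x y"
  define n where "n = complex_of_real ((hnorm x)\<^sup>2)"
  have n: "n \<noteq> 0" "cnj n = n" "cinner x x = n" using pos by (auto simp: n_def cinner_self)
  let ?z = "y - (c / n) *\<^sub>C x"
  have yx: "cinner y x = cnj c"
    unfolding c_def by (rule cinner_conj_sym)
  have "cinner ?z ?z = cinner y y - c * cnj c / n"
    using n by (simp add: cinner_simps yx flip: c_def)
  also have "\<dots> = complex_of_real ((hnorm y)\<^sup>2 - (cmod c)\<^sup>2 / (hnorm x)\<^sup>2)"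
    by (simp add: cinner_self n_def complex_norm_square[symmetric])
  finally have "0 \<le> (hnorm y)\<^sup>2 - (cmod c)\<^sup>2 / (hnorm x)\<^sup>2"
    using cinner_pos[of ?z] by simp
  then have "(cmod c)\<^sup>2 \<le> (hnorm x * hnorm y)\<^sup>2"
    using pos by (simp add: field_simps)
  then show ?thesis unfolding c_def by (rule power2_le_imp_le) simp
qed simp

lemma hnorm_triangle: "hnorm (x + y) \<le> hnorm x + hnorm (y::'a::cinner_space)"
proof -
  have "(hnorm (x + y))\<^sup>2 = (hnorm x)\<^sup>2 + (hnorm y)\<^sup>2 + 2 * Re (cinner x y)"
    using cinner_conj_sym[of y x]
    by (simp add: hnorm_square cinner_simps)
  also have "\<dots> \<le> (hnorm x)\<^sup>2 + (hnorm y)\<^sup>2 + 2 * (hnorm x * hnorm y)"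
    using cinner_Cauchy_Schwarz[of x y] complex_Re_le_cmod[of "cinner x y"] by linarith
  also have "\<dots> = (hnorm x + hnorm y)\<^sup>2" by (simp add: power2_sum)
  finally show ?thesis by (rule power2_le_imp_le) simp
qed

lemma hnorm_sum: "hnorm (sum g S) \<le> (\<Sum>i\<in>S. hnorm (g i :: 'a::cinner_space))"
  by (induction S rule: infinite_finite_induct) (auto intro: order_trans[OF hnorm_triangle])

lemma hnorm_minus [simp]: "hnorm (- x) = hnorm (x::'a::cinner_space)"
  by (simp add: hnorm_def cinner_minus_left cinner_minus_right)

text \<open>A group is not the union of two proper subgroups. \<open>P\<close> and \<open>Q\<close>
  are used in cancellation form: if \<open>x\<close> fails \<open>P\<close> and \<open>y\<close>
  fails \<open>Q\<close>, then \<open>x + y\<close> can satisfy neither.\<close>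

lemma all_or_all_subgroups:
  fixes D :: "'a::ab_group_add set"
  assumes "\<And>x y. x \<in> D \<Longrightarrow> y \<in> D \<Longrightarrow> x + y \<in> D"
    and P: "\<And>x y. x \<in> D \<Longrightarrow> y \<in> D \<Longrightarrow> P x \<Longrightarrow> P (x + y) \<Longrightarrow> P y"
    and Q: "\<And>x y. x \<in> D \<Longrightarrow> y \<in> D \<Longrightarrow> Q x \<Longrightarrow> Q (x + y) \<Longrightarrow> Q y"
    and "\<And>x. x \<in> D \<Longrightarrow> P x \<or> Q x"
  shows "(\<forall>x\<in>D. P x) \<or> (\<forall>x\<in>D. Q x)"
proof (rule ccontr)
  assume "\<not> ?thesis"
  then obtain x y where "x \<in> D" "y \<in> D" "\<not> P x" "\<not> Q y" by blast
  with assms P[of y x] Q[of x y] show False by (metis add.commute)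
qed

section \<open>Finite-rank operators\<close>

locale inner_subspace =
  fixes D :: "'a::chilbert set"
  assumes zero_in [simp]: "0 \<in> D"
    and add_in [simp]: "x \<in> D \<Longrightarrow> y \<in> D \<Longrightarrow> x + y \<in> D"
    and scale_in [simp]: "x \<in> D \<Longrightarrow> c *\<^sub>C x \<in> D"
begin

lemma minus_in [simp]: "x \<in> D \<Longrightarrow> - x \<in> D"
  using scale_in[of x "-1"] by simp

lemma diff_in [simp]: "x \<in> D \<Longrightarrow> y \<in> D \<Longrightarrow> x - y \<in> D"
  using add_in[of x "- y"] by simp

lemma sum_in [simp]: "(\<And>i. i \<in> S \<Longrightarrow> g i \<in> D) \<Longrightarrow> sum g S \<in> D"
  by (induction S rule: infinite_finite_induct) auto

lemma tensor_in [simp]: "a \<in> D \<Longrightarrow> tensor D a b x \<in> D"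
  by (simp add: tensor_def)

section \<open>Algebra of the rank-one operators \<open>tensor D a b\<close>\<close>

lemma tensor_apply: "x \<in> D \<Longrightarrow> tensor D a b x = cinner b x *\<^sub>C a"
  by (simp add: tensor_def)

lemma tensor_add_left: "tensor D (a + a') b = (\<lambda>x. tensor D a b x + tensor D a' b x)"
  by (auto simp: tensor_def cvec.scale_right_distrib)

lemma tensor_add_right: "tensor D a (b + b') = (\<lambda>x. tensor D a b x + tensor D a b' x)"
  by (auto simp: tensor_def cvec.scale_left_distrib cinner_add_left)

lemma tensor_minus_left: "tensor D (- a) b = (\<lambda>x. - tensor D a b x)"
  by (auto simp: tensor_def)

lemma tensor_diff_left: "tensor D (a - a') b = (\<lambda>x. tensor D a b x - tensor D a' b x)"
  by (auto simp: tensor_def cvec.scale_right_diff_distrib)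

lemma tensor_diff_right: "tensor D a (b - b') = (\<lambda>x. tensor D a b x - tensor D a b' x)"
  by (auto simp: tensor_def cvec.scale_left_diff_distrib cinner_diff_left)

lemma tensor_scale_left: "tensor D (c *\<^sub>C a) b = opscale c (tensor D a b)"
  by (auto simp: tensor_def opscale_def mult.commute)

lemma tensor_scale_right: "tensor D a (c *\<^sub>C b) = opscale (cnj c) (tensor D a b)"
  by (auto simp: tensor_def opscale_def cinner_scaleC_left)

lemma tensor_zero [simp]: "tensor D 0 b = (\<lambda>_. 0)" "tensor D a 0 = (\<lambda>_. 0)"
  by (auto simp: tensor_def)

lemma tensor_swap_scale: "tensor D (c *\<^sub>C a) b = tensor D a (cnj c *\<^sub>C b)"
  by (simp add: tensor_scale_left tensor_scale_right)

lemma tensor_swap_scale': "tensor D a (c *\<^sub>C b) = tensor D (cnj c *\<^sub>C a) b"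
  by (simp add: tensor_scale_left tensor_scale_right)

lemma tensor_left_parallel:
  assumes "tensor D p g = tensor D a q" "g \<in> D" "g \<noteq> 0"
  shows "\<exists>k. p = k *\<^sub>C a"
proof
  have "cinner g g *\<^sub>C p = cinner q g *\<^sub>C a"
    using fun_cong[OF assms(1), of g] assms(2) by (simp add: tensor_apply)
  then have "inverse (cinner g g) *\<^sub>C cinner g g *\<^sub>C p = inverse (cinner g g) *\<^sub>C cinner q g *\<^sub>C a"
    by simp
  then show "p = (inverse (cinner g g) * cinner q g) *\<^sub>C a"
    using assms by simp
qed

lemma tensor_left_cancel:
  assumes "tensor D p g = tensor D p' g" "g \<in> D" "g \<noteq> 0"
  shows "p = p'"
  using fun_cong[OF assms(1), of g] assms(2,3) by (simp add: tensor_apply)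

text \<open>The pairing \<open>cinner b a\<close> is the trace of \<open>tensor D a b\<close>, hence
  depends on the operator alone. Evaluating at \<open>a\<close> and pairing with \<open>b'\<close>
  gives \<open>t = t * cinner b' a'\<close> for \<open>t = cinner b' a\<close>, and pairing with
  \<open>b\<close> shows that \<open>t\<close> is nonzero.\<close>

lemma tensor_trace:
  assumes "tensor D a b = tensor D a' b'" "a \<in> D" "b \<in> D" "b' \<in> D" "cinner b a = 1"
  shows "cinner b' a' = 1"
proof -
  have "a = cinner b' a *\<^sub>C a'"
    using fun_cong[OF assms(1), of a] assms(2,5) by (simp add: tensor_apply scaleC_one)
  then have a: "cinner b' a = cinner b' a * cinner b' a'" and "cinner b a = cinner b' a * cinner b a'"
    by (metis cinner_scaleC_right)+
  with assms(5) have "cinner b' a \<noteq> 0" by auto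
  with a show ?thesis by simp
qed

lemma tensor_nonzero:
  assumes "b \<in> D" "a \<noteq> 0" "b \<noteq> 0"
  shows "tensor D a b \<noteq> (\<lambda>_. 0)"
  using tensor_left_cancel[of a b 0] assms by auto

text \<open>If \<open>q\<close> is not a multiple of \<open>g\<close>, its component
  \<open>w\<close> orthogonal to \<open>g\<close> isolates the second summand: evaluation at
  \<open>w\<close> puts \<open>c\<close> on the line of \<open>a\<close>, and evaluation at
  \<open>g\<close> then puts \<open>p\<close> there too.\<close>

lemma sum_of_tensors_rank_one:
  assumes eq: "(\<lambda>x. tensor D p g x + tensor D a q x) = tensor D c d"
    and D: "p \<in> D" "g \<in> D" "a \<in> D" "q \<in> D" "c \<in> D" "d \<in> D"
  shows "(\<exists>h\<in>D. tensor D p g = tensor D a h) \<or> (\<exists>h\<in>D. tensor D a q = tensor D h g)"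
proof (cases "g = 0 \<or> a = 0")
  case True
  then show ?thesis
  proof
    assume "g = 0"
    then have "tensor D p g = tensor D a 0" by simp
    then show ?thesis using zero_in by blast
  next
    assume "a = 0"
    then have "tensor D a q = tensor D 0 g" by simp
    then show ?thesis using zero_in by blast
  qed
next
  case False
  define k where "k = cinner g q / cinner g g"
  define w where "w = q - k *\<^sub>C g"
  have w: "w \<in> D" "cinner g w = 0"
    using D False by (auto simp: w_def k_def cinner_simps)
  show ?thesis
  proof (cases "w = 0")
    case True
    then have "q = k *\<^sub>C g" by (simp add: w_def)
    then have "tensor D a q = tensor D (cnj k *\<^sub>C a) g" by (simp add: tensor_swap_scale')
    then show ?thesis using D scale_in by blast
  next
    case nz: False
    have "cinner w q = cinner w w"
      using w(2) cinner_conj_sym[of w g] by (simp add: w_def cinner_simps)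
    then have qw: "cinner q w \<noteq> 0"
      using nz cinner_conj_sym[of q w] by (metis cinner_eq_0_iff complex_cnj_zero_iff)
    have ac: "cinner q w *\<^sub>C a = cinner d w *\<^sub>C c"
      using fun_cong[OF eq, of w] w by (simp add: tensor_apply)
    with qw False have "cinner d w \<noteq> 0" by auto
    with arg_cong[OF ac, of "\<lambda>v. inverse (cinner d w) *\<^sub>C v"]
    obtain m where c: "c = m *\<^sub>C a" by (metis cvec.scale_scale left_inverse scaleC_one)
    have "cinner g g *\<^sub>C p + cinner q g *\<^sub>C a = cinner d g *\<^sub>C m *\<^sub>C a"
      using fun_cong[OF eq, of g] D by (simp add: tensor_apply c)
    then have "cinner g g *\<^sub>C p = (cinner d g * m - cinner q g) *\<^sub>C a"
      by (simp add: cvec.scale_left_diff_distrib eq_diff_eq)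
    from arg_cong[OF this, of "\<lambda>v. inverse (cinner g g) *\<^sub>C v"] False
    obtain l where "p = l *\<^sub>C a" by (auto simp: scaleC_one)
    then have "tensor D p g = tensor D a (cnj l *\<^sub>C g)" by (simp add: tensor_swap_scale)
    then show ?thesis using D scale_in by blast
  qed
qed

lemma pairing_one:
  assumes "f \<in> D" "f \<noteq> 0"
  obtains u where "u \<in> D" "cinner f u = 1"
  using assms that[of "inverse (cinner f f) *\<^sub>C f"] by (simp add: cinner_simps)

lemma pairing_one':
  assumes "x \<in> D" "x \<noteq> 0"
  obtains f where "f \<in> D" "cinner f x = 1"
  using assms pairing_one[of x] cinner_conj_sym by (metis complex_cnj_one)

lemma pairing_one_two:
  assumes "x \<in> D" "y \<in> D" "x \<noteq> 0" "\<And>k. y \<noteq> k *\<^sub>C x"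
  obtains f where "f \<in> D" "cinner f x = 1" "cinner f y = 1"
proof -
  define k where "k = cinner x y / cinner x x"
  define w where "w = y - k *\<^sub>C x"
  have w: "w \<in> D" "w \<noteq> 0" "cinner x w = 0"
    using assms by (auto simp: w_def k_def cinner_simps)
  have wx: "cinner w x = 0" using w(3) cinner_conj_sym[of w x] by simp
  have y: "y = k *\<^sub>C x + w" by (simp add: w_def)
  \<comment> \<open>The \<open>x\<close> term gives pairing 1 with \<open>x\<close>; the
    \<open>w\<close> term, invisible to \<open>x\<close>, corrects the pairing with
    \<open>y = k *\<^sub>C x + w\<close> from \<open>cnj k\<close> to 1.\<close>
  define v where "v = inverse (cinner x x) *\<^sub>C x + ((1 - cnj k) / cinner w w) *\<^sub>C w"
  have v: "v \<in> D" "cinner x v = 1" "cinner w v = 1 - cnj k"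
    using assms w wx by (auto simp: v_def cinner_simps)
  have "cinner y v = 1"
    by (subst y) (simp add: cinner_simps v)
  with v show ?thesis using that[of v] cinner_conj_sym by (metis complex_cnj_one)
qed

lemma tensor_finrank [simp]: "a \<in> D \<Longrightarrow> b \<in> D \<Longrightarrow> tensor D a b \<in> finrank D"
  unfolding finrank_def tensor_def by (auto intro!: exI[of _ "[(a, b)]"])

lemma zero_finrank [simp]: "(\<lambda>_. 0) \<in> finrank D"
  using tensor_finrank[of 0 0] by simp

lemma add_finrank [simp]:
  assumes "S \<in> finrank D" "T \<in> finrank D"
  shows "(\<lambda>x. S x + T x) \<in> finrank D"
proof -
  from assms obtain xs ys where "set xs \<subseteq> D \<times> D" "set ys \<subseteq> D \<times> D"
    "S = (\<lambda>\<xi>. if \<xi> \<in> D then sum_list (map (\<lambda>(\<phi>, \<psi>). cinner \<psi> \<xi> *\<^sub>C \<phi>) xs) else 0)"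
    "T = (\<lambda>\<xi>. if \<xi> \<in> D then sum_list (map (\<lambda>(\<phi>, \<psi>). cinner \<psi> \<xi> *\<^sub>C \<phi>) ys) else 0)"
    unfolding finrank_def by blast
  then show ?thesis
    unfolding finrank_def by (auto intro!: exI[of _ "xs @ ys"])
qed

lemma finrank_induct [consumes 1, case_names zero add]:
  assumes "T \<in> finrank D"
    and "P (\<lambda>_. 0)"
    and "\<And>a b T. a \<in> D \<Longrightarrow> b \<in> D \<Longrightarrow> T \<in> finrank D \<Longrightarrow> P T \<Longrightarrow> P (\<lambda>x. tensor D a b x + T x)"
  shows "P T"
proof -
  let ?op = "\<lambda>xs \<xi>. if \<xi> \<in> D then sum_list (map (\<lambda>(\<phi>, \<psi>). cinner \<psi> \<xi> *\<^sub>C \<phi>) xs) else 0"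
  have "P (?op xs)" if "set xs \<subseteq> D \<times> D" for xs
    using that
  proof (induction xs)
    case Nil
    then show ?case using assms(2) by (simp cong: if_cong)
  next
    case (Cons y xs)
    obtain a b where y: "y = (a, b)" by force
    have "?op xs \<in> finrank D" using Cons unfolding finrank_def by auto
    with Cons y assms(3)[of a b "?op xs"] have "P (\<lambda>x. tensor D a b x + ?op xs x)" by auto
    also have "(\<lambda>x. tensor D a b x + ?op xs x) = ?op (y # xs)" by (auto simp: tensor_def y)
    finally show ?case .
  qed
  then show ?thesis using assms(1) unfolding finrank_def by blast
qed

lemma finrank_in [simp]: "T \<in> finrank D \<Longrightarrow> T x \<in> D"
  by (induction T rule: finrank_induct) auto

lemma finrank_outside: "T \<in> finrank D \<Longrightarrow> x \<notin> D \<Longrightarrow> T x = 0"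
  by (auto simp: finrank_def)

lemma opscale_finrank [simp]: "T \<in> finrank D \<Longrightarrow> opscale c T \<in> finrank D"
proof (induction T rule: finrank_induct)
  case zero
  then show ?case by (simp add: opscale_def)
next
  case (add a b T)
  have "opscale c (\<lambda>x. tensor D a b x + T x) = (\<lambda>x. tensor D (c *\<^sub>C a) b x + opscale c T x)"
    by (simp add: tensor_scale_left opscale_def cvec.scale_right_distrib)
  with add show ?case by simp
qed

text \<open>Unlike \<^term>\<open>adjp D T\<close>, this adjoint vanishes off \<^term>\<open>D\<close>, as the canonical
  representatives in \<^term>\<open>finrank D\<close> do.\<close>
definition radj :: "('a \<Rightarrow> 'a) \<Rightarrow> 'a \<Rightarrow> 'a" where
  "radj T = (\<lambda>x. if x \<in> D then adjp D T x else 0)"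

lemma adjp_eqI:
  assumes "z \<in> D" "\<And>y. y \<in> D \<Longrightarrow> cinner z y = cinner x (T y)"
  shows "adjp D T x = z"
  unfolding adjp_def
proof (rule the_equality)
  fix w assume w: "w \<in> D \<and> (\<forall>y\<in>D. cinner w y = cinner x (T y))"
  then have "cinner (w - z) (w - z) = 0"
    using assms by (simp add: cinner_diff_left)
  then show "w = z" by simp
qed (use assms in auto)

lemma radj_tensor [simp]:
  assumes "a \<in> D" "b \<in> D"
  shows "radj (tensor D a b) = tensor D b a"
proof
  fix x show "radj (tensor D a b) x = tensor D b a x"
    using assms cinner_conj_sym[of a x]
    by (auto simp: radj_def tensor_apply cinner_simps tensor_def intro!: adjp_eqI)
qed

text \<open>\<open>adjp\<close> is a definite description, so its value on a sum is computed from
  adjoint vectors already known for the summands. Membership and the adjoint identity are therefore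
  carried through one induction.\<close>

lemma radj_finrank_aux:
  assumes "T \<in> finrank D"
  shows "radj T \<in> finrank D \<and> (\<forall>x\<in>D. \<forall>y\<in>D. cinner (radj T x) y = cinner x (T y))"
  using assms
proof (induction T rule: finrank_induct)
  case zero
  then show ?case using radj_tensor[of 0 0] by simp
next
  case (add a b T)
  have *: "cinner (tensor D b a x + radj T x) y = cinner x (tensor D a b y + T y)"
    if "x \<in> D" "y \<in> D" for x y
    using add that cinner_conj_sym[of a x] by (simp add: cinner_simps tensor_apply)
  have "radj (\<lambda>x. tensor D a b x + T x) = (\<lambda>x. tensor D b a x + radj T x)"
  proof
    fix x show "radj (\<lambda>x. tensor D a b x + T x) x = tensor D b a x + radj T x"
    proof (cases "x \<in> D")
      case True
      then show ?thesis
        using add * by (subst radj_def) (auto intro!: adjp_eqI)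
    qed (simp add: radj_def tensor_def)
  qed
  with add * show ?case by simp
qed

lemma radj_finrank [simp]: "T \<in> finrank D \<Longrightarrow> radj T \<in> finrank D"
  and cinner_radj: "T \<in> finrank D \<Longrightarrow> x \<in> D \<Longrightarrow> y \<in> D \<Longrightarrow> cinner (radj T x) y = cinner x (T y)"
  using radj_finrank_aux by blast+

lemma radj_eqI:
  assumes "S \<in> finrank D" "\<And>x y. x \<in> D \<Longrightarrow> y \<in> D \<Longrightarrow> cinner (S x) y = cinner x (T y)"
  shows "radj T = S"
proof
  fix x show "radj T x = S x"
    using assms by (cases "x \<in> D") (auto simp: radj_def finrank_outside intro!: adjp_eqI)
qed

lemma radj_radj [simp]: "T \<in> finrank D \<Longrightarrow> radj (radj T) = T"
  by (rule radj_eqI) (metis cinner_radj cinner_conj_sym)+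

lemma radj_add: "S \<in> finrank D \<Longrightarrow> T \<in> finrank D \<Longrightarrow> radj (\<lambda>x. S x + T x) = (\<lambda>x. radj S x + radj T x)"
  by (rule radj_eqI) (simp_all add: cinner_simps cinner_radj)

lemma radj_opscale: "T \<in> finrank D \<Longrightarrow> radj (opscale c T) = opscale (cnj c) (radj T)"
  by (rule radj_eqI, simp) (simp add: opscale_def cinner_simps cinner_radj)

lemma radj_image: "radj ` finrank D = finrank D"
  by (metis image_eqI radj_finrank radj_radj subsetI subset_antisym image_subsetI)

lemma rank_one_proj_radj: "rank_one_proj D P \<Longrightarrow> rank_one_proj D (radj P)"
  unfolding rank_one_proj_def by (metis cinner_conj_sym complex_cnj_one radj_tensor)

lemma rank_one_proj_finrank: "rank_one_proj D P \<Longrightarrow> P \<in> finrank D"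
  unfolding rank_one_proj_def by auto

text \<open>The first word names the factor of \<open>x \<otimes> f\<close> that is kept fixed, the
  last word the factor of the image that is then constant. Applied to
  \<open>\<Phi> \<circ> radj\<close>, the same predicates describe operators with a fixed left
  factor.\<close>

definition right_to_right :: "(('a \<Rightarrow> 'a) \<Rightarrow> 'a \<Rightarrow> 'a) \<Rightarrow> 'a \<Rightarrow> bool" where
  "right_to_right \<Phi> f \<longleftrightarrow> (\<exists>g\<in>D. \<forall>x\<in>D. \<exists>p\<in>D. \<Phi> (tensor D x f) = tensor D p g)"

definition right_to_left :: "(('a \<Rightarrow> 'a) \<Rightarrow> 'a \<Rightarrow> 'a) \<Rightarrow> 'a \<Rightarrow> bool" where
  "right_to_left \<Phi> f \<longleftrightarrow> (\<exists>a\<in>D. \<forall>x\<in>D. \<exists>q\<in>D. \<Phi> (tensor D x f) = tensor D a q)"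

text \<open>Pointwise dependence gives a ratio at each \<open>x\<close> with
  \<open>A x \<noteq> 0\<close>. For \<open>x\<close>, \<open>y\<close> with independent images,
  comparison with \<open>x + y\<close> equates the two ratios; since the range of \<open>A\<close>
  is not on a line, every such vector can be compared with \<open>x1\<close> or
  \<open>x2\<close>.\<close>

lemma locally_dependent_additive:
  assumes A: "\<And>x y. x \<in> D \<Longrightarrow> y \<in> D \<Longrightarrow> A (x + y) = A x + (A y :: 'a)"
    and P: "\<And>x y. x \<in> D \<Longrightarrow> y \<in> D \<Longrightarrow> P (x + y) = P x + (P y :: 'a)"
    and par: "\<And>x. x \<in> D \<Longrightarrow> \<exists>v k l. A x = k *\<^sub>C v \<and> P x = l *\<^sub>C v"
    and x12: "x1 \<in> D" "x2 \<in> D" "A x1 \<noteq> 0" "\<And>k. A x2 \<noteq> k *\<^sub>C A x1"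
  shows "\<exists>c. \<forall>x\<in>D. P x = c *\<^sub>C A x"
proof -
  have ex: "\<exists>c. P x = c *\<^sub>C A x" if x: "x \<in> D" "A x \<noteq> 0" for x
  proof -
    obtain v k l where "A x = k *\<^sub>C v" "P x = l *\<^sub>C v" using par x by blast
    with x have "P x = (l / k) *\<^sub>C A x" by auto
    then show ?thesis ..
  qed
  have same: "c = d"
    if xy: "x \<in> D" "y \<in> D" and "A x \<noteq> 0" and ind: "\<And>k. A y \<noteq> k *\<^sub>C A x"
      and c: "P x = c *\<^sub>C A x" and d: "P y = d *\<^sub>C A y" for x y c d
  proof -
    have "A x + A y \<noteq> 0"
    proof
      assume "A x + A y = 0"
      then have "A y = (- 1) *\<^sub>C A x" by (simp add: scaleC_one eq_neg_iff_add_eq_0 add.commute)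
      with ind show False by blast
    qed
    then have "A (x + y) \<noteq> 0" using A[OF xy] by simp
    then obtain e where "P (x + y) = e *\<^sub>C A (x + y)" using ex[of "x + y"] xy by auto
    then have "c *\<^sub>C A x + d *\<^sub>C A y = e *\<^sub>C A x + e *\<^sub>C A y"
      using A[OF xy] P[OF xy] c d by (simp add: cvec.scale_right_distrib)
    then have eq: "(c - e) *\<^sub>C A x = (e - d) *\<^sub>C A y"
      by (simp add: cvec.scale_left_diff_distrib algebra_simps)
    have "e = d"
    proof (rule ccontr)
      assume "e \<noteq> d"
      then have "A y = inverse (e - d) *\<^sub>C (e - d) *\<^sub>C A y" by (simp add: scaleC_one)
      also have "\<dots> = (inverse (e - d) * (c - e)) *\<^sub>C A x" by (simp flip: eq)
      finally show False using ind by blast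
    qed
    with eq that show ?thesis by simp
  qed
  obtain c where c: "P x1 = c *\<^sub>C A x1" using ex x12 by blast
  have nz2: "A x2 \<noteq> 0" using x12(4)[of 0] by simp
  then obtain c' where c': "P x2 = c' *\<^sub>C A x2" using ex x12 by blast
  have cc': "c = c'" using same[OF x12(1,2,3,4) c c'] .
  have main: "P x = c *\<^sub>C A x" if x: "x \<in> D" "A x \<noteq> 0" for x
  proof -
    obtain d where d: "P x = d *\<^sub>C A x" using ex x by blast
    show ?thesis
    proof (cases "\<exists>k. A x = k *\<^sub>C A x1")
      case False
      then have "c = d" using same[OF x12(1) x(1) x12(3) _ c d] by blast
      with d show ?thesis by simp
    next
      \<comment> \<open>On the line of \<open>A x1\<close> the comparison goes through
        \<open>x2\<close> instead.\<close>
      case True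
      then obtain k where k: "A x = k *\<^sub>C A x1" ..
      have "A x2 \<noteq> m *\<^sub>C A x" for m
        using x12(4)[of "m * k"] k by (simp add: scaleC_scaleC)
      then have "c' = d" using same[OF x(1) x12(2) x(2) _ d c'] by blast
      with d cc' show ?thesis by simp
    qed
  qed
  have "P x = c *\<^sub>C A x" if x: "x \<in> D" for x
  proof (cases "A x = 0")
    \<comment> \<open>Shifting by \<open>x1\<close> moves \<open>x\<close> off the kernel of
      \<open>A\<close>, and additivity then gives \<open>P x = 0\<close>.\<close>
    case True
    then have "P (x + x1) = c *\<^sub>C A (x + x1)"
      using main[of "x + x1"] x x12 A by simp
    then show ?thesis using True x x12 A P c by simp
  qed (use main x in blast)
  then show ?thesis by blast
qed

end

section \<open>Preservers of rank-one projections\<close>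

text \<open>\<open>not_line\<close> makes \<open>D\<close> at least two-dimensional, which serves
  the purely algebraic argument; orthonormal sequences and completeness enter with the continuity of
  the twist.\<close>

locale proj_preserver = inner_subspace D for D :: "'a::chilbert set" +
  fixes \<Phi> :: "('a \<Rightarrow> 'a) \<Rightarrow> 'a \<Rightarrow> 'a"
  assumes onto: "\<Phi> ` finrank D = finrank D"
    and additive: "S \<in> finrank D \<Longrightarrow> T \<in> finrank D \<Longrightarrow> \<Phi> (\<lambda>x. S x + T x) = (\<lambda>x. \<Phi> S x + \<Phi> T x)"
    and proj: "rank_one_proj D P \<Longrightarrow> rank_one_proj D (\<Phi> P)"
    and proj_span: "rank_one_proj D P \<Longrightarrow> \<exists>d. \<Phi> (opscale c P) = opscale d (\<Phi> P)"
    and not_line: "a \<in> D \<Longrightarrow> \<exists>b\<in>D. \<forall>k. b \<noteq> k *\<^sub>C a"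
begin

lemma maps [simp]: "T \<in> finrank D \<Longrightarrow> \<Phi> T \<in> finrank D"
  using onto by blast

lemma Phi_zero [simp]: "\<Phi> (\<lambda>_. 0) = (\<lambda>_. 0)"
proof -
  have "\<Phi> (\<lambda>_. 0) x = \<Phi> (\<lambda>_. 0) x + \<Phi> (\<lambda>_. 0) x" for x
    using fun_cong[OF additive[of "\<lambda>_. 0" "\<lambda>_. 0"], of x] by simp
  then show ?thesis by auto
qed

lemma Phi_add_left:
  "x \<in> D \<Longrightarrow> y \<in> D \<Longrightarrow> f \<in> D \<Longrightarrow>
    \<Phi> (tensor D (x + y) f) = (\<lambda>z. \<Phi> (tensor D x f) z + \<Phi> (tensor D y f) z)"
  by (simp add: tensor_add_left additive)

lemma Phi_add_right:
  "x \<in> D \<Longrightarrow> f \<in> D \<Longrightarrow> g \<in> D \<Longrightarrow>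
    \<Phi> (tensor D x (f + g)) = (\<lambda>z. \<Phi> (tensor D x f) z + \<Phi> (tensor D x g) z)"
  by (simp add: tensor_add_right additive)

lemma Phi_proj:
  assumes "x \<in> D" "f \<in> D" "cinner f x = 1"
  shows "\<exists>a\<in>D. \<exists>b\<in>D. cinner b a = 1 \<and> \<Phi> (tensor D x f) = tensor D a b"
  using proj[of "tensor D x f"] assms unfolding rank_one_proj_def by blast

lemma Phi_span:
  assumes "x \<in> D" "f \<in> D" "cinner f x = 1"
  shows "\<exists>d. \<Phi> (tensor D (c *\<^sub>C x) f) = opscale d (\<Phi> (tensor D x f))"
  using proj_span[of "tensor D x f" c] assms
  unfolding rank_one_proj_def by (auto simp: tensor_scale_left)

text \<open>By surjectivity the images of the operators \<open>x \<otimes> f\<close> generate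
  \<open>finrank D\<close> additively.\<close>

lemma Phi_finrank_induct:
  assumes "T \<in> finrank D"
    and "P (\<lambda>_. 0)"
    and "\<And>S T. P S \<Longrightarrow> P T \<Longrightarrow> P (\<lambda>x. S x + T x)"
    and "\<And>x f. x \<in> D \<Longrightarrow> f \<in> D \<Longrightarrow> P (\<Phi> (tensor D x f))"
  shows "P T"
proof -
  obtain S where S: "S \<in> finrank D" "T = \<Phi> S" using assms(1) onto by blast
  have "P (\<Phi> S)"
    using S(1)
  proof (induction S rule: finrank_induct)
    case zero
    then show ?case using assms(2) by simp
  next
    case (add a b T)
    then show ?case using assms(3,4) by (simp add: additive)
  qed
  with S show ?thesis by simp
qed

text \<open>Otherwise surjectivity would put the range of every finite-rank operator on the line of
  \<open>a\<close>, whereas \<open>tensor D b b\<close> has its range off that line.\<close>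

lemma image_not_in_row:
  assumes "a \<in> D"
  shows "\<exists>x\<in>D. \<exists>f\<in>D. \<forall>q\<in>D. \<Phi> (tensor D x f) \<noteq> tensor D a q"
proof (rule ccontr)
  assume "\<not> ?thesis"
  then have *: "\<exists>q\<in>D. \<Phi> (tensor D x f) = tensor D a q" if "x \<in> D" "f \<in> D" for x f
    using that by blast
  obtain b where b: "b \<in> D" "\<forall>k. b \<noteq> k *\<^sub>C a" using not_line assms by blast
  have "\<exists>q\<in>D. T = tensor D a q" if "T \<in> finrank D" for T
    using that
  proof (rule Phi_finrank_induct)
    show "\<exists>q\<in>D. (\<lambda>_. 0) = tensor D a q"
      by (intro bexI[of _ 0]) auto
    show "\<exists>q\<in>D. (\<lambda>x. S x + T x) = tensor D a q"
      if "\<exists>q\<in>D. S = tensor D a q" "\<exists>q\<in>D. T = tensor D a q" for S T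
    proof -
      from that obtain q q' where "q \<in> D" "S = tensor D a q" "q' \<in> D" "T = tensor D a q'" by blast
      then show ?thesis by (intro bexI[of _ "q + q'"]) (simp_all add: tensor_add_right)
    qed
  qed (use * in blast)
  then obtain q where "tensor D b b = tensor D a q" using b by (meson tensor_finrank)
  moreover have "b \<noteq> 0" using b(2)[rule_format, of 0] by auto
  ultimately show False using tensor_left_parallel b by blast
qed

text \<open>Precomposition with the adjoint swaps the factors of the argument, and postcomposition,
  in \<open>proj_preserver_adjoint\<close>, those of the image; so each result about one factor
  yields its mirror.\<close>

lemma proj_preserver_flip: "proj_preserver D (\<Phi> \<circ> radj)"
proof
  show "(\<Phi> \<circ> radj) ` finrank D = finrank D"
    by (metis image_comp radj_image onto)
  show "\<exists>d. (\<Phi> \<circ> radj) (opscale c P) = opscale d ((\<Phi> \<circ> radj) P)" if "rank_one_proj D P" for c P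
    using proj_span[OF rank_one_proj_radj[OF that]] that
    by (simp add: radj_opscale rank_one_proj_finrank)
qed (simp_all add: radj_add additive proj rank_one_proj_radj not_line)

lemma proj_preserver_adjoint: "proj_preserver D (radj \<circ> \<Phi>)"
proof
  show "(radj \<circ> \<Phi>) ` finrank D = finrank D"
    by (metis image_comp radj_image onto)
  show "\<exists>d. (radj \<circ> \<Phi>) (opscale c P) = opscale d ((radj \<circ> \<Phi>) P)" if P: "rank_one_proj D P" for c P
  proof -
    obtain d where "\<Phi> (opscale c P) = opscale d (\<Phi> P)" using proj_span[OF P] by blast
    then show ?thesis
      using P by (auto simp: radj_opscale rank_one_proj_finrank)
  qed
qed (simp_all add: radj_add additive proj rank_one_proj_radj not_line)

section \<open>Common functional or common range for a fixed right factor\<close>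

lemma row_cancel:
  assumes D: "x \<in> D" "y \<in> D" "f \<in> D"
    and "\<exists>q\<in>D. \<Phi> (tensor D x f) = tensor D a q" "\<exists>q\<in>D. \<Phi> (tensor D (x + y) f) = tensor D a q"
  shows "\<exists>q\<in>D. \<Phi> (tensor D y f) = tensor D a q"
proof -
  obtain q q' where q: "q \<in> D" "q' \<in> D" "\<Phi> (tensor D x f) = tensor D a q"
    "\<Phi> (tensor D (x + y) f) = tensor D a q'" using assms by blast
  have "\<Phi> (tensor D y f) z = \<Phi> (tensor D (x + y) f) z - \<Phi> (tensor D x f) z" for z
    by (simp add: Phi_add_left[OF D])
  then have "\<Phi> (tensor D y f) = tensor D a (q' - q)"
    by (intro ext) (simp add: q tensor_diff_right)
  with q show ?thesis by (intro bexI[of _ "q' - q"]) auto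
qed

lemma column_cancel:
  assumes D: "x \<in> D" "y \<in> D" "f \<in> D"
    and "\<exists>p\<in>D. \<Phi> (tensor D x f) = tensor D p g" "\<exists>p\<in>D. \<Phi> (tensor D (x + y) f) = tensor D p g"
  shows "\<exists>p\<in>D. \<Phi> (tensor D y f) = tensor D p g"
proof -
  obtain q q' where q: "q \<in> D" "q' \<in> D" "\<Phi> (tensor D x f) = tensor D q g"
    "\<Phi> (tensor D (x + y) f) = tensor D q' g" using assms by blast
  have "\<Phi> (tensor D y f) z = \<Phi> (tensor D (x + y) f) z - \<Phi> (tensor D x f) z" for z
    by (simp add: Phi_add_left[OF D])
  then have "\<Phi> (tensor D y f) = tensor D (q' - q) g"
    by (intro ext) (simp add: q tensor_diff_left)
  with q show ?thesis by (intro bexI[of _ "q' - q"]) auto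
qed

text \<open>With \<open>\<langle>f, u\<rangle> = 1\<close>, the alternative is settled pointwise,
  first on the kernel of \<open>f\<close> and then on \<open>D\<close> by splitting off a multiple
  of \<open>u\<close>; the subgroup lemma makes it uniform in \<open>x\<close>.\<close>

lemma right_dichotomy:
  assumes f: "f \<in> D"
  shows "right_to_right \<Phi> f \<or> right_to_left \<Phi> f"
proof (cases "f = 0")
  case True
  then have "\<Phi> (tensor D x f) = tensor D 0 0" for x by simp
  then show ?thesis unfolding right_to_right_def using zero_in by blast
next
  case False
  then obtain u where u: "u \<in> D" "cinner f u = 1" using pairing_one f by blast
  then obtain a g where ag: "a \<in> D" "g \<in> D" "cinner g a = 1" "\<Phi> (tensor D u f) = tensor D a g"
    using Phi_proj f by blast
  let ?P = "\<lambda>x. \<exists>q\<in>D. \<Phi> (tensor D x f) = tensor D a q"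
  let ?Q = "\<lambda>x. \<exists>p\<in>D. \<Phi> (tensor D x f) = tensor D p g"
  have kernel: "?P x \<or> ?Q x" if x: "x \<in> D" "cinner f x = 0" for x
  proof -
    obtain a1 g1 where 1: "a1 \<in> D" "g1 \<in> D" "\<Phi> (tensor D (u + x) f) = tensor D a1 g1"
      using Phi_proj[of "u + x" f] f u x by (auto simp: cinner_simps)
    obtain a2 g2 where 2: "a2 \<in> D" "g2 \<in> D" "\<Phi> (tensor D (u - x) f) = tensor D a2 g2"
      using Phi_proj[of "u - x" f] f u x by (auto simp: cinner_simps)
    have sum_eq: "tensor D a1 g1 z + tensor D a2 g2 z = tensor D (2 *\<^sub>C a) g z" for z
    proof -
      have "\<Phi> (tensor D (u + x) f) z + \<Phi> (tensor D (u - x) f) z = \<Phi> (tensor D (u + x + (u - x)) f) z"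
        using Phi_add_left[of "u + x" "u - x" f] u x f by simp
      also have "\<dots> = \<Phi> (tensor D u f) z + \<Phi> (tensor D u f) z"
        using Phi_add_left[of u u f] u f by simp
      also have "\<dots> = tensor D (2 *\<^sub>C a) g z"
        by (simp add: ag tensor_scale_left opscale_def flip: cvec.scale_left_distrib[of 1 1, simplified scaleC_one])
      finally show ?thesis by (simp add: 1 2)
    qed
    \<comment> \<open>Moving one summand across lets \<open>sum_of_tensors_rank_one\<close> apply to
      the two terms that make up the image of \<open>x \<otimes> f\<close>, up to the factor 2 on
      \<open>a\<close>.\<close>
    have eq: "(\<lambda>z. tensor D (2 *\<^sub>C a) g z + tensor D (- a2) g2 z) = tensor D a1 g1"
      by (rule ext) (simp add: tensor_minus_left flip: sum_eq)
    have "\<Phi> (tensor D x f) z = tensor D a g z - tensor D a2 g2 z" for z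
      using Phi_add_left[of "u - x" x f] u x f by (simp add: ag 2)
    then have x_eq: "\<Phi> (tensor D x f) = (\<lambda>z. tensor D a g z + tensor D (- a2) g2 z)"
      by (simp add: tensor_minus_left fun_eq_iff)
    from sum_of_tensors_rank_one[OF eq]
      ag 1 2
    have "(\<exists>h\<in>D. tensor D (2 *\<^sub>C a) g = tensor D (- a2) h) \<or> (\<exists>h\<in>D. tensor D (- a2) g2 = tensor D h g)"
      by simp
    then show ?thesis
    proof
      assume "\<exists>h\<in>D. tensor D (- a2) g2 = tensor D h g"
      then obtain h where "h \<in> D" "tensor D (- a2) g2 = tensor D h g" ..
      then have "\<Phi> (tensor D x f) = tensor D (a + h) g" by (simp add: x_eq tensor_add_left)
      then show ?thesis using ag \<open>h \<in> D\<close> add_in by blast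
    next
      assume "\<exists>h\<in>D. tensor D (2 *\<^sub>C a) g = tensor D (- a2) h"
      then obtain h where h: "h \<in> D" "tensor D (2 *\<^sub>C a) g = tensor D (- a2) h" ..
      have g0: "g \<noteq> 0" and a0: "a \<noteq> 0" using ag by auto
      obtain k where "2 *\<^sub>C a = k *\<^sub>C (- a2)" using tensor_left_parallel[OF h(2)] ag g0 by blast
      moreover from this a0 have "k \<noteq> 0" by auto
      ultimately have "- a2 = (2 / k) *\<^sub>C a"
        by (metis (no_types, lifting) cvec.scale_scale divide_inverse_commute left_inverse scaleC_one)
      then have "tensor D (- a2) g2 = tensor D a (cnj (2 / k) *\<^sub>C g2)"
        by (simp only: tensor_swap_scale)
      then have "\<Phi> (tensor D x f) = tensor D a (g + cnj (2 / k) *\<^sub>C g2)"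
        by (simp add: x_eq tensor_add_right)
      then show ?thesis using ag 2 by (metis add_in scale_in)
    qed
  qed
  have all: "?P x \<or> ?Q x" if x: "x \<in> D" for x
  proof -
    define c where "c = cinner f x"
    \<comment> \<open>By \<open>proj_span\<close> the part along \<open>u\<close> goes to a multiple
      of \<open>a \<otimes> g\<close>, which can be absorbed in either alternative.\<close>
    obtain d where d: "\<Phi> (tensor D (c *\<^sub>C u) f) = opscale d (tensor D a g)"
      using Phi_span[of u f c] u f ag by auto
    have "\<Phi> (tensor D x f) = (\<lambda>z. \<Phi> (tensor D (c *\<^sub>C u) f) z + \<Phi> (tensor D (x - c *\<^sub>C u) f) z)"
      using Phi_add_left[of "c *\<^sub>C u" "x - c *\<^sub>C u" f] u f x by simp
    then have eq: "\<Phi> (tensor D x f) = (\<lambda>z. tensor D (d *\<^sub>C a) g z + \<Phi> (tensor D (x - c *\<^sub>C u) f) z)"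
      by (simp only: d tensor_scale_left[of d a g])
    have "cinner f (x - c *\<^sub>C u) = 0" using u by (simp add: c_def cinner_simps)
    with kernel[of "x - c *\<^sub>C u"] x u consider
        q where "q \<in> D" "\<Phi> (tensor D (x - c *\<^sub>C u) f) = tensor D a q"
      | p where "p \<in> D" "\<Phi> (tensor D (x - c *\<^sub>C u) f) = tensor D p g" by auto
    then show ?thesis
    proof cases
      case 1
      then have "\<Phi> (tensor D x f) = tensor D a (cnj d *\<^sub>C g + q)"
        by (simp add: eq tensor_swap_scale tensor_add_right)
      then show ?thesis using 1 ag by (metis add_in scale_in)
    next
      case 2
      then have "\<Phi> (tensor D x f) = tensor D (d *\<^sub>C a + p) g"
        by (simp add: eq tensor_add_left)
      then show ?thesis using 2 ag by (metis add_in scale_in)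
    qed
  qed
  have "(\<forall>x\<in>D. ?P x) \<or> (\<forall>x\<in>D. ?Q x)"
  proof (rule all_or_all_subgroups)
    fix x y assume D: "x \<in> D" "y \<in> D"
    show "?P y" if "?P x" "?P (x + y)" using row_cancel that D f by blast
    show "?Q y" if "?Q x" "?Q (x + y)" using column_cancel that D f by blast
  qed (use all in auto)
  then show ?thesis
    unfolding right_to_right_def right_to_left_def using ag by blast
qed

text \<open>If \<open>f1\<close> keeps only the range \<open>a\<close> and \<open>f2\<close> only
  the functional \<open>g\<close>, the image of \<open>x \<otimes> (f1 + f2)\<close> has rank at
  most one and is an \<open>a\<close> row plus a \<open>g\<close> column. One of the two summands
  must fit the other pattern, by the subgroup lemma the same one for all \<open>x\<close>, against
  the choice of \<open>f1\<close> and \<open>f2\<close>.\<close>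

lemma right_uniform:
  "(\<forall>f\<in>D. right_to_right \<Phi> f) \<or> (\<forall>f\<in>D. right_to_left \<Phi> f)"
proof (rule ccontr)
  assume "\<not> ?thesis"
  then obtain f1 f2 where f: "f1 \<in> D" "f2 \<in> D" and not: "\<not> right_to_right \<Phi> f1" "\<not> right_to_left \<Phi> f2"
    by blast
  then have "right_to_left \<Phi> f1" "right_to_right \<Phi> f2" using right_dichotomy by blast+
  then obtain a g where ag: "a \<in> D" "g \<in> D"
    and L: "\<And>x. x \<in> D \<Longrightarrow> \<exists>q\<in>D. \<Phi> (tensor D x f1) = tensor D a q"
    and R: "\<And>x. x \<in> D \<Longrightarrow> \<exists>p\<in>D. \<Phi> (tensor D x f2) = tensor D p g"
    unfolding right_to_left_def right_to_right_def by blast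
  let ?P = "\<lambda>x. \<exists>q\<in>D. \<Phi> (tensor D x f2) = tensor D a q"
  let ?Q = "\<lambda>x. \<exists>p\<in>D. \<Phi> (tensor D x f1) = tensor D p g"
  have "?P x \<or> ?Q x" if x: "x \<in> D" for x
  proof -
    obtain p q where pq: "p \<in> D" "q \<in> D" "\<Phi> (tensor D x f1) = tensor D a q" "\<Phi> (tensor D x f2) = tensor D p g"
      using L R x by blast
    obtain c d where "c \<in> D" "d \<in> D" "\<Phi> (tensor D x (f1 + f2)) = tensor D c d"
      using right_dichotomy[OF add_in[OF f]] x unfolding right_to_right_def right_to_left_def by blast
    moreover from this have "(\<lambda>z. tensor D p g z + tensor D a q z) = tensor D c d"
      using Phi_add_right[OF x f] pq by (simp add: add.commute)
    ultimately show ?thesis using sum_of_tensors_rank_one[of p g a q c d] pq ag by simp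
  qed
  have "(\<forall>x\<in>D. ?P x) \<or> (\<forall>x\<in>D. ?Q x)"
  proof (rule all_or_all_subgroups)
    fix x y assume D: "x \<in> D" "y \<in> D"
    show "?P y" if "?P x" "?P (x + y)" using row_cancel that D f by blast
    show "?Q y" if "?Q x" "?Q (x + y)" using column_cancel that D f by blast
  qed (use \<open>\<And>x. x \<in> D \<Longrightarrow> ?P x \<or> ?Q x\<close> in auto)
  then show False
    using not ag unfolding right_to_left_def right_to_right_def by blast
qed

text \<open>Some \<open>y \<otimes> f'\<close> is mapped outside the row \<open>a\<close> belonging
  to \<open>x\<close>, so \<open>y\<close> is off the line of \<open>x\<close> and one
  \<open>f\<close> pairs to 1 with both. Dependent image ranges at \<open>f\<close> would put the
  whole row of \<open>y\<close> into that of \<open>a\<close>.\<close>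

lemma independent_images:
  assumes rows: "\<forall>x\<in>D. \<exists>a\<in>D. \<forall>f\<in>D. \<exists>q\<in>D. \<Phi> (tensor D x f) = tensor D a q"
  obtains x1 x2 f a1 a2 b1 b2 where "x1 \<in> D" "x2 \<in> D" "f \<in> D"
    "a1 \<in> D" "a2 \<in> D" "b1 \<in> D" "b2 \<in> D" "cinner b1 a1 = 1" "cinner b2 a2 = 1"
    "\<Phi> (tensor D x1 f) = tensor D a1 b1" "\<Phi> (tensor D x2 f) = tensor D a2 b2"
    "\<And>k. a2 \<noteq> k *\<^sub>C a1"
proof -
  obtain x where x: "x \<in> D" "x \<noteq> 0" using not_line[of 0] by auto
  obtain a where a: "a \<in> D" "\<And>f. f \<in> D \<Longrightarrow> \<exists>q\<in>D. \<Phi> (tensor D x f) = tensor D a q"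
    using rows x by blast
  obtain y f' where y: "y \<in> D" "f' \<in> D" and ne: "\<And>q. q \<in> D \<Longrightarrow> \<Phi> (tensor D y f') \<noteq> tensor D a q"
    using image_not_in_row[OF a(1)] by blast
  have y_ind: "y \<noteq> k *\<^sub>C x" for k
  proof
    assume "y = k *\<^sub>C x"
    then have "tensor D y f' = tensor D x (cnj k *\<^sub>C f')" by (simp add: tensor_swap_scale)
    with a(2)[of "cnj k *\<^sub>C f'"] y ne show False by auto
  qed
  then obtain f where f: "f \<in> D" "cinner f x = 1" "cinner f y = 1"
    using pairing_one_two x y by metis
  obtain a1 b1 where 1: "a1 \<in> D" "b1 \<in> D" "cinner b1 a1 = 1" "\<Phi> (tensor D x f) = tensor D a1 b1"
    using Phi_proj f x by blast
  obtain a2 b2 where 2: "a2 \<in> D" "b2 \<in> D" "cinner b2 a2 = 1" "\<Phi> (tensor D y f) = tensor D a2 b2"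
    using Phi_proj f y by blast
  have b: "b1 \<noteq> 0" "b2 \<noteq> 0" using 1 2 by auto
  have "a2 \<noteq> k *\<^sub>C a1" for k
  proof
    assume k: "a2 = k *\<^sub>C a1"
    obtain l where "a1 = l *\<^sub>C a" using a(2)[OF f(1)] 1 b tensor_left_parallel by metis
    with k have a2: "a2 = (k * l) *\<^sub>C a" by (simp add: scaleC_scaleC)
    obtain a' where a': "\<And>f. f \<in> D \<Longrightarrow> \<exists>q\<in>D. \<Phi> (tensor D y f) = tensor D a' q"
      using rows y by blast
    obtain q where q: "q \<in> D" "\<Phi> (tensor D y f') = tensor D a' q" using a' y by blast
    obtain q2 where q2: "q2 \<in> D" "\<Phi> (tensor D y f) = tensor D a' q2" using a' f by blast
    with 2 b obtain m where m: "a2 = m *\<^sub>C a'" using tensor_left_parallel by metis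
    have "a2 \<noteq> 0" using 2 by auto
    with m have "a' = inverse m *\<^sub>C a2" by (auto simp: scaleC_one)
    then have "a' = (inverse m * (k * l)) *\<^sub>C a" by (simp only: a2 scaleC_scaleC)
    then have "\<Phi> (tensor D y f') = tensor D a (cnj (inverse m * (k * l)) *\<^sub>C q)"
      by (simp only: q tensor_swap_scale)
    with ne q show False by (metis scale_in)
  qed
  with 1 2 x y f show ?thesis using that[of x y f a1 a2 b1 b2] by blast
qed

text \<open>\<open>right_to_left\<close> for \<open>\<Phi> \<circ> radj\<close> is the row
  hypothesis of \<open>independent_images\<close>, which supplies two independent image ranges for
  one \<open>f\<close>; \<open>right_to_left \<Phi> f\<close> puts both on one line.\<close>

lemma not_both_right_to_left:
  assumes "\<forall>f\<in>D. right_to_left \<Phi> f" "\<forall>f\<in>D. right_to_left (\<Phi> \<circ> radj) f"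
  shows False
proof -
  have "\<forall>x\<in>D. \<exists>a\<in>D. \<forall>f\<in>D. \<exists>q\<in>D. \<Phi> (tensor D x f) = tensor D a q"
    using assms(2) unfolding right_to_left_def by fastforce
  then obtain x1 x2 f a1 a2 b1 b2 where *: "x1 \<in> D" "x2 \<in> D" "f \<in> D"
    "a1 \<in> D" "a2 \<in> D" "b1 \<in> D" "b2 \<in> D" "cinner b1 a1 = 1" "cinner b2 a2 = 1"
    "\<Phi> (tensor D x1 f) = tensor D a1 b1" "\<Phi> (tensor D x2 f) = tensor D a2 b2"
    "\<And>k. a2 \<noteq> k *\<^sub>C a1"
    by (rule independent_images) blast
  then obtain a where a: "\<And>x. x \<in> D \<Longrightarrow> \<exists>q\<in>D. \<Phi> (tensor D x f) = tensor D a q"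
    using assms(1) unfolding right_to_left_def by blast
  have "b1 \<noteq> 0" "b2 \<noteq> 0" "a1 \<noteq> 0" using * by auto
  then obtain k l where "a1 = k *\<^sub>C a" "a2 = l *\<^sub>C a"
    using a[of x1] a[of x2] * tensor_left_parallel by metis
  with \<open>a1 \<noteq> 0\<close> have "a2 = (l / k) *\<^sub>C a1" by auto
  with * show False by blast
qed

text \<open>Postcomposition with the adjoint turns common functionals into common ranges and so
  reduces this to the previous case.\<close>

lemma not_both_right_to_right:
  assumes "\<forall>f\<in>D. right_to_right \<Phi> f" "\<forall>f\<in>D. right_to_right (\<Phi> \<circ> radj) f"
  shows False
proof -
  interpret adj: proj_preserver D "radj \<circ> \<Phi>" by (rule proj_preserver_adjoint)
  have "\<forall>f\<in>D. right_to_left (radj \<circ> \<Phi>) f"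
    using assms(1) unfolding right_to_left_def right_to_right_def by (metis comp_apply radj_tensor)
  moreover have "\<forall>f\<in>D. right_to_left (radj \<circ> \<Phi> \<circ> radj) f"
    using assms(2) unfolding right_to_left_def right_to_right_def by (metis comp_apply radj_tensor)
  ultimately show False by (rule adj.not_both_right_to_left)
qed

section \<open>Factorisation of \<open>\<Phi>\<close> on rank-one operators\<close>

text \<open>On \<open>a \<otimes> b\<close> both sides equal
  \<open>\<tau> \<langle>b, u\<rangle>\<close> times \<open>A a\<close>; additivity of
  \<open>\<Phi>\<close> and \<open>A\<close> extends this to finite sums.\<close>

lemma intertwine:
  assumes A: "\<And>x. x \<in> D \<Longrightarrow> A x \<in> D" "\<And>x y. x \<in> D \<Longrightarrow> y \<in> D \<Longrightarrow> A (x + y) = A x + A y"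
      "\<And>c x. x \<in> D \<Longrightarrow> A (c *\<^sub>C x) = \<tau> c *\<^sub>C A x"
    and fac: "\<And>x f. x \<in> D \<Longrightarrow> f \<in> D \<Longrightarrow> \<Phi> (tensor D x f) = tensor D (A x) (B f)"
    and pair: "\<And>x f. x \<in> D \<Longrightarrow> f \<in> D \<Longrightarrow> cinner (B f) (A x) = \<tau> (cinner f x)"
    and "T \<in> finrank D" and u: "u \<in> D"
  shows "\<Phi> T (A u) = A (T u)"
  using \<open>T \<in> finrank D\<close>
proof (induction T rule: finrank_induct)
  case zero
  show ?case using A(2)[of 0 0] by simp
next
  case (add a b T)
  then show ?case using A u by (simp add: additive fac pair tensor_apply)
qed

text \<open>One fixed functional \<open>f0\<close> defines \<open>A\<close>. Any other
  \<open>f\<close> with nonzero images gives a map locally dependent on \<open>A\<close>, because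
  the row of \<open>x\<close> fixes the range; it is a scalar multiple of \<open>A\<close>, and the
  scalar is absorbed into \<open>B f\<close>. The twist \<open>\<tau> c\<close> comes from the same
  lemma applied to \<open>x \<mapsto> A (c x)\<close>.\<close>

lemma factorization:
  assumes RR: "\<forall>f\<in>D. right_to_right \<Phi> f" and RL: "\<forall>x\<in>D. right_to_left (\<Phi> \<circ> radj) x"
  obtains A B \<tau> where
    "\<And>x. x \<in> D \<Longrightarrow> A x \<in> D" "\<And>f. f \<in> D \<Longrightarrow> B f \<in> D"
    "\<And>x y. x \<in> D \<Longrightarrow> y \<in> D \<Longrightarrow> A (x + y) = A x + A y"
    "\<And>c x. x \<in> D \<Longrightarrow> A (c *\<^sub>C x) = \<tau> c *\<^sub>C A x"
    "\<And>x. x \<in> D \<Longrightarrow> x \<noteq> 0 \<Longrightarrow> A x \<noteq> 0"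
    "\<And>x f. x \<in> D \<Longrightarrow> f \<in> D \<Longrightarrow> cinner (B f) (A x) = \<tau> (cinner f x)"
    "\<And>x f. x \<in> D \<Longrightarrow> f \<in> D \<Longrightarrow> \<Phi> (tensor D x f) = tensor D (A x) (B f)"
proof -
  have rows: "\<forall>x\<in>D. \<exists>a\<in>D. \<forall>f\<in>D. \<exists>q\<in>D. \<Phi> (tensor D x f) = tensor D a q"
    using RL unfolding right_to_left_def by fastforce
  then obtain x1 x2 f0 a1 a2 b1 b2 where *: "x1 \<in> D" "x2 \<in> D" "f0 \<in> D"
    "a1 \<in> D" "a2 \<in> D" "b1 \<in> D" "b2 \<in> D" "cinner b1 a1 = 1" "cinner b2 a2 = 1"
    "\<Phi> (tensor D x1 f0) = tensor D a1 b1" "\<Phi> (tensor D x2 f0) = tensor D a2 b2"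
    and ind: "\<And>k. a2 \<noteq> k *\<^sub>C a1"
    by (rule independent_images) blast
  have nz: "a1 \<noteq> 0" "b1 \<noteq> 0" "b2 \<noteq> 0" using * by auto
  have columns: "\<exists>g\<in>D. \<exists>P. \<forall>x\<in>D. P x \<in> D \<and> \<Phi> (tensor D x f) = tensor D (P x) g" if "f \<in> D" for f
    using RR that unfolding right_to_right_def by metis
  then obtain g0 A where g0: "g0 \<in> D" and A_in: "\<And>x. x \<in> D \<Longrightarrow> A x \<in> D"
    and A: "\<And>x. x \<in> D \<Longrightarrow> \<Phi> (tensor D x f0) = tensor D (A x) g0"
    using \<open>f0 \<in> D\<close> by metis
  have g0_nz: "g0 \<noteq> 0"
  proof
    assume "g0 = 0"
    then have "tensor D a1 b1 = (\<lambda>_. 0)" using A[of x1] * by simp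
    then show False using tensor_nonzero * nz by blast
  qed
  have add_of_fac: "P (x + y) = P x + P y"
    if P: "\<And>x. x \<in> D \<Longrightarrow> \<Phi> (tensor D x f) = tensor D (P x) g" and fg: "f \<in> D" "g \<in> D" "g \<noteq> 0"
      and xy: "x \<in> D" "y \<in> D" for P f g x y
  proof -
    have "tensor D (P (x + y)) g = tensor D (P x + P y) g"
      using P[of "x + y"] P[of x] P[of y] Phi_add_left[OF xy fg(1)] xy by (simp add: tensor_add_left)
    then show ?thesis using tensor_left_cancel fg by blast
  qed
  have A_add: "A (x + y) = A x + A y" if "x \<in> D" "y \<in> D" for x y
    using add_of_fac[of f0 A g0 x y] A * g0 g0_nz that by blast
  \<comment> \<open>The operators \<open>a1 \<otimes> b1\<close> and
    \<open>A x1 \<otimes> g0\<close> coincide, so independence of \<open>a1\<close>,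
    \<open>a2\<close> passes to \<open>A x1\<close>, \<open>A x2\<close>.\<close>
  obtain k1 where k1: "a1 = k1 *\<^sub>C A x1"
    using tensor_left_parallel[of a1 b1 "A x1" g0] A[of x1] * nz by auto
  obtain k2 where k2: "a2 = k2 *\<^sub>C A x2"
    using tensor_left_parallel[of a2 b2 "A x2" g0] A[of x2] * nz by auto
  have A1: "A x1 \<noteq> 0" and k1_nz: "k1 \<noteq> 0" using k1 nz by auto
  have A_ind: "A x2 \<noteq> k *\<^sub>C A x1" for k
  proof
    assume "A x2 = k *\<^sub>C A x1"
    then have "a2 = (k2 * k / k1) *\<^sub>C a1" using k1_nz by (simp add: k1 k2)
    with ind show False by blast
  qed
  have "\<exists>b\<in>D. \<forall>x\<in>D. \<Phi> (tensor D x f) = tensor D (A x) b" if f: "f \<in> D" for f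
  proof -
    obtain g P where g: "g \<in> D" and P_in: "\<And>x. x \<in> D \<Longrightarrow> P x \<in> D"
      and P: "\<And>x. x \<in> D \<Longrightarrow> \<Phi> (tensor D x f) = tensor D (P x) g"
      using columns[OF f] by blast
    show ?thesis
    proof (cases "g = 0")
      case True
      with P g show ?thesis by (intro bexI[of _ g]) auto
    next
      case False
      have "\<exists>c. \<forall>x\<in>D. P x = c *\<^sub>C A x"
      proof (rule locally_dependent_additive[OF A_add _ _ *(1,2) A1 A_ind])
        show "P (x + y) = P x + P y" if "x \<in> D" "y \<in> D" for x y
          using add_of_fac[of f P g x y] P f g False that by blast
        show "\<exists>v k l. A x = k *\<^sub>C v \<and> P x = l *\<^sub>C v" if x: "x \<in> D" for x
        proof -
          obtain a where a: "\<forall>f\<in>D. \<exists>q\<in>D. \<Phi> (tensor D x f) = tensor D a q" using rows x by blast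
          obtain q q' where "tensor D (A x) g0 = tensor D a q" "tensor D (P x) g = tensor D a q'"
            using a * f A[OF x] P[OF x] by metis
          with g g0 g0_nz False show ?thesis by (meson tensor_left_parallel)
        qed
      qed
      then obtain c where c: "\<forall>x\<in>D. P x = c *\<^sub>C A x" by blast
      have "\<Phi> (tensor D x f) = tensor D (A x) (cnj c *\<^sub>C g)" if x: "x \<in> D" for x
        using P[OF x] c x by (simp add: tensor_swap_scale)
      with g show ?thesis by (intro bexI[of _ "cnj c *\<^sub>C g"]) auto
    qed
  qed
  then obtain B where B_in: "\<And>f. f \<in> D \<Longrightarrow> B f \<in> D"
    and fac: "\<And>x f. x \<in> D \<Longrightarrow> f \<in> D \<Longrightarrow> \<Phi> (tensor D x f) = tensor D (A x) (B f)"
    by metis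
  have pair_one: "cinner (B f) (A x) = 1" if xf: "x \<in> D" "f \<in> D" "cinner f x = 1" for x f
  proof -
    obtain a b where "a \<in> D" "b \<in> D" "cinner b a = 1" "\<Phi> (tensor D x f) = tensor D a b"
      using Phi_proj xf by blast
    then show ?thesis using tensor_trace[of a b "A x" "B f"] fac xf B_in by simp
  qed
  have A_zero: "A 0 = 0" using A_add[of 0 0] by simp
  have "\<exists>t. \<forall>x\<in>D. A (c *\<^sub>C x) = t *\<^sub>C A x" for c
  proof (rule locally_dependent_additive[OF A_add _ _ *(1,2) A1 A_ind])
    show "A (c *\<^sub>C (x + y)) = A (c *\<^sub>C x) + A (c *\<^sub>C y)" if "x \<in> D" "y \<in> D" for x y
      using that A_add by (simp add: cvec.scale_right_distrib)
    show "\<exists>v k l. A x = k *\<^sub>C v \<and> A (c *\<^sub>C x) = l *\<^sub>C v" if x: "x \<in> D" for x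
    proof (cases "x = 0")
      case True
      then show ?thesis using A_zero by (intro exI[of _ 0]) simp
    next
      case False
      then obtain f where f: "f \<in> D" "cinner f x = 1" using pairing_one' x by blast
      obtain d where d: "\<Phi> (tensor D (c *\<^sub>C x) f) = opscale d (\<Phi> (tensor D x f))"
        using Phi_span[OF x f] by blast
      have "tensor D (A (c *\<^sub>C x)) (B f) = tensor D (d *\<^sub>C A x) (B f)"
        using d x f by (simp add: fac tensor_scale_left[of d])
      moreover have "B f \<noteq> 0" using pair_one[OF x f] by auto
      ultimately have "A (c *\<^sub>C x) = d *\<^sub>C A x" using tensor_left_cancel B_in f by blast
      moreover have "A x = 1 *\<^sub>C A x" by (simp add: scaleC_one)
      ultimately show ?thesis by blast
    qed
  qed
  then obtain \<tau> where \<tau>: "\<And>c x. x \<in> D \<Longrightarrow> A (c *\<^sub>C x) = \<tau> c *\<^sub>C A x" by metis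
  have A_nz: "A x \<noteq> 0" if x: "x \<in> D" "x \<noteq> 0" for x
  proof -
    obtain f where f: "f \<in> D" "cinner f x = 1" using pairing_one' x by blast
    then show ?thesis using pair_one[OF x(1) f] by auto
  qed
  have tau0: "\<tau> 0 = 0" using \<tau>[of x1 0] * A_zero A1 by auto
  \<comment> \<open>Pairing 1 is preserved by the trace, and nonzero values follow by rescaling
    \<open>x\<close>. For value 0 and \<open>f \<noteq> 0\<close>, adding \<open>x\<close> to a
    \<open>u\<close> with pairing 1 keeps the pairing, so \<open>A x\<close> contributes nothing;
    \<open>f = 0\<close> forces \<open>B f = 0\<close>.\<close>
  have pair: "cinner (B f) (A x) = \<tau> (cinner f x)" if xf: "x \<in> D" "f \<in> D" for x f
  proof (cases "cinner f x = 0")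
    case False
    define c where "c = cinner f x"
    define y where "y = inverse c *\<^sub>C x"
    have y: "y \<in> D" "cinner f y = 1" "x = c *\<^sub>C y"
      using False xf by (auto simp: y_def c_def cinner_simps scaleC_one)
    have "cinner (B f) (A x) = \<tau> c * cinner (B f) (A y)"
      using y by (simp add: \<tau> cinner_simps)
    then show ?thesis using pair_one[OF y(1) xf(2) y(2)] by (simp add: c_def)
  next
    case True
    show ?thesis
    proof (cases "f = 0")
      case f0: True
      then have "tensor D (A x1) (B f) = (\<lambda>_. 0)" using fac[of x1 f] * xf by simp
      then have "B f = 0" using tensor_nonzero[of "B f" "A x1"] A1 B_in xf by blast
      with f0 tau0 show ?thesis by simp
    next
      case False
      then obtain u where u: "u \<in> D" "cinner f u = 1" using pairing_one xf by blast
      then have "cinner (B f) (A (u + x)) = 1"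
        using True xf by (intro pair_one) (auto simp: cinner_simps)
      then show ?thesis
        using pair_one[OF u(1) xf(2) u(2)] A_add u xf True tau0 by (simp add: cinner_simps)
    qed
  qed
  show ?thesis using that[of A B \<tau>] A_in B_in A_add \<tau> A_nz pair fac by blast
qed

end

section \<open>Continuity of the scalar twist\<close>

text \<open>Multiplicativity upgrades boundedness near 0 to contractivity on the open unit disc.
  Integers are fixed, so reducing \<open>n r\<close> modulo 1 keeps \<open>n (\<tau> r - r)\<close>
  bounded and reals are fixed as well; \<open>\<i>\<close> goes to a square root of -1.\<close>

lemma ring_hom_bounded_near_zero:
  fixes \<tau> :: "complex \<Rightarrow> complex"
  assumes add: "\<And>a b. \<tau> (a + b) = \<tau> a + \<tau> b" and mult: "\<And>a b. \<tau> (a * b) = \<tau> a * \<tau> b"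
    and one: "\<tau> 1 = 1"
    and "0 < \<delta>" and bdd: "\<And>c. cmod c < \<delta> \<Longrightarrow> cmod (\<tau> c) \<le> M"
  shows "\<tau> = id \<or> \<tau> = cnj"
proof -
  have zero: "\<tau> 0 = 0" using add[of 0 0] by simp
  have minus: "\<tau> (- a) = - \<tau> a" for a
    using add[of a "- a"] zero by (simp add: eq_neg_iff_add_eq_0 add.commute)
  have diff: "\<tau> (a - b) = \<tau> a - \<tau> b" for a b
    using add[of a "- b"] minus by simp
  have of_nat: "\<tau> (of_nat n) = of_nat n" for n
    by (induction n) (auto simp: zero one add)
  have of_int: "\<tau> (of_int n) = of_int n" for n
    by (cases n) (auto simp: of_nat minus one add diff simp del: of_nat_Suc)
  have power: "\<tau> (c ^ k) = \<tau> c ^ k" for c k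
    by (induction k) (simp_all add: one mult)
  have contraction: "cmod (\<tau> c) \<le> 1" if c: "cmod c < 1" for c
  proof (rule ccontr)
    assume "\<not> ?thesis"
    then have gt: "1 < cmod (\<tau> c)" by simp
    \<comment> \<open>The exponent \<open>n\<close> brings the power of \<open>c\<close> below
      \<open>\<delta>\<close>, the exponent \<open>m\<close> lifts that of \<open>\<tau> c\<close>
      above \<open>M\<close>; neither spoils the other.\<close>
    obtain m where m: "M < cmod (\<tau> c) ^ m" using real_arch_pow[OF gt] by blast
    obtain n where n: "cmod c ^ n < \<delta>" using real_arch_pow_inv[OF \<open>0 < \<delta>\<close> c] by blast
    have "cmod (c ^ (n + m)) \<le> cmod c ^ n"
      using c by (simp add: norm_power power_decreasing)
    then have "cmod (\<tau> (c ^ (n + m))) \<le> M" using n bdd by simp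
    moreover have "cmod (\<tau> c) ^ m \<le> cmod (\<tau> c) ^ (n + m)"
      using gt by (intro power_increasing) auto
    ultimately show False using m by (simp add: power norm_power)
  qed
  have real: "\<tau> (of_real r) = of_real r" for r
  proof (rule ccontr)
    assume "\<tau> (of_real r) \<noteq> of_real r"
    \<comment> \<open>The 2 is the triangle bound for \<open>\<tau> s - s\<close> with
      \<open>s\<close> in \<open>[0, 1)\<close>.\<close>
    then obtain n :: nat where n: "2 < real n * cmod (\<tau> (of_real r) - of_real r)"
      using ex_less_of_nat_mult[of "cmod (\<tau> (of_real r) - of_real r)" 2] by auto
    define s where "s = frac (real n * r)"
    have "complex_of_real s = of_real (real n * r) - of_int \<lfloor>real n * r\<rfloor>"
      by (simp add: s_def frac_def)
    then have s: "complex_of_real s = of_nat n * of_real r - of_int \<lfloor>real n * r\<rfloor>" by simp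
    have \<tau>s: "\<tau> (of_real s) = of_nat n * \<tau> (of_real r) - of_int \<lfloor>real n * r\<rfloor>"
      unfolding s by (simp only: mult diff of_nat of_int)
    have "of_nat n * (\<tau> (of_real r) - of_real r)
      = (of_nat n * \<tau> (of_real r) - of_int \<lfloor>real n * r\<rfloor>) - (of_nat n * of_real r - of_int \<lfloor>real n * r\<rfloor>)"
      by (simp add: right_diff_distrib)
    also have "\<dots> = \<tau> (of_real s) - of_real s"
      by (simp only: \<tau>s[symmetric] s[symmetric])
    finally have "real n * cmod (\<tau> (of_real r) - of_real r) = cmod (\<tau> (of_real s) - of_real s)"
      by (metis norm_mult norm_of_nat)
    also have "\<dots> \<le> cmod (\<tau> (of_real s)) + cmod (of_real s)"
      by (rule norm_triangle_ineq4)
    also have "\<dots> \<le> 1 + 1"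
      by (intro add_mono contraction) (simp_all add: s_def frac_lt_1 less_imp_le)
    finally show False using n by simp
  qed
  have "\<tau> \<i> * \<tau> \<i> = -1"
    using mult[of \<i> \<i>] minus one by simp
  then have "(\<tau> \<i> - \<i>) * (\<tau> \<i> + \<i>) = 0" by (simp add: algebra_simps)
  then have "\<tau> \<i> = \<i> \<or> \<tau> \<i> = - \<i>" by (auto simp: eq_neg_iff_add_eq_0)
  moreover have "\<tau> z = of_real (Re z) + \<tau> \<i> * of_real (Im z)" for z
    by (subst complex_eq[of z]) (simp only: add mult real)
  ultimately have "(\<forall>z. \<tau> z = z) \<or> (\<forall>z. \<tau> z = cnj z)"
    by (metis complex_cnj_add complex_cnj_complex_of_real complex_cnj_i complex_cnj_mult complex_eq)
  then show ?thesis by (simp add: fun_eq_iff)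
qed

section \<open>Fourier coefficients realised in \<open>D\<close>\<close>

lemma (in inner_subspace) Lplus_ident: "Lplus D (\<lambda>x. x)"
  unfolding Lplus_def clinear_on_def by auto

lemma (in inner_subspace) clinear_on_sum:
  assumes "clinear_on D A" "\<And>i. i \<in> I \<Longrightarrow> v i \<in> D"
  shows "A (\<Sum>i\<in>I. c i *\<^sub>C v i) = (\<Sum>i\<in>I. c i *\<^sub>C A (v i))"
proof -
  have add: "A (x + y) = A x + A y" and scale: "A (k *\<^sub>C x) = k *\<^sub>C A x" if "x \<in> D" "y \<in> D" for x y k
    using assms(1) that unfolding clinear_on_def by blast+
  have "A 0 = 0" using add[of 0 0] by simp
  then show ?thesis
    using assms(2) by (induction I rule: infinite_finite_induct) (simp_all add: add scale[OF _ zero_in])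
qed

definition orthonormal_seq :: "(nat \<Rightarrow> 'a::cinner_space) \<Rightarrow> bool" where
  "orthonormal_seq e \<longleftrightarrow> (\<forall>i j. cinner (e i) (e j) = (if i = j then 1 else 0))"

lemma orthonormal_hnorm: "orthonormal_seq e \<Longrightarrow> hnorm (e i) = 1"
  by (simp add: orthonormal_seq_def hnorm_def)

text \<open>Any sequence of Fourier coefficients that decays fast enough relative to the first
  \<^term>\<open>i\<close> seminorms of \<^term>\<open>e i\<close> is realised in \<^term>\<open>D\<close>.\<close>

lemma (in inner_subspace) orthonormal_series:
  assumes F: "graph_F_space D" and e: "orthonormal_seq e" and e_in: "\<And>i. e i \<in> D"
  shows "\<exists>s. (\<forall>i. 0 \<le> s i) \<and>
    (\<forall>c. (\<forall>i. cmod (c i) * s i \<le> (1 / 2) ^ i) \<longrightarrow> (\<exists>x\<in>D. \<forall>i. cinner (e i) x = c i))"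
proof -
  obtain S :: "nat \<Rightarrow> 'a \<Rightarrow> 'a" where S: "\<And>A. Lplus D A \<Longrightarrow> \<exists>k C. \<forall>x\<in>D. hnorm (A x) \<le> C * Max {hnorm (S j x) | j. j \<le> k}"
    using F unfolding graph_F_space_def graph_metrizable_def by blast
  \<comment> \<open>The number of seminorms grows with \<open>i\<close>, so for any fixed
    \<open>k\<close> the maximum of the first \<open>k + 1\<close> seminorms at \<open>e i\<close>
    is at most \<open>s i\<close> once \<open>k \<le> i\<close>.\<close>
  define s where "s i = Max {hnorm (S j (e i)) | j. j \<le> i}" for i
  have img: "{hnorm (S j x) | j. j \<le> i} = (\<lambda>j. hnorm (S j x)) ` {..i}" for x and i :: nat
    by auto
  have s_nonneg: "0 \<le> s i" for i
  proof -
    have "hnorm (S 0 (e i)) \<le> s i" unfolding s_def img by (rule Max_ge) auto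
    then show ?thesis using order_trans[OF hnorm_nonneg] by blast
  qed
  have "\<exists>x\<in>D. \<forall>i. cinner (e i) x = c i" if c: "\<And>i. cmod (c i) * s i \<le> (1 / 2) ^ i" for c
  proof -
    define X where "X n = (\<Sum>i<n. c i *\<^sub>C e i)" for n
    have X_in: "X n \<in> D" for n unfolding X_def using e_in by auto
    have Cauchy: "\<exists>N. \<forall>m\<ge>N. \<forall>n\<ge>N. hnorm (A (X m - X n)) < \<epsilon>"
      if A: "Lplus D A" and "0 < \<epsilon>" for A \<epsilon>
    proof -
      have lin: "clinear_on D A" using A by (simp add: Lplus_def)
      obtain k C where kC: "\<And>x. x \<in> D \<Longrightarrow> hnorm (A x) \<le> C * Max {hnorm (S j x) | j. j \<le> k}"
        using S[OF A] by blast
      define r where "r i = cmod (c i) * hnorm (A (e i))" for i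
      \<comment> \<open>The absolute value covers a negative \<open>C\<close>; the tail
        \<open>k \<le> i\<close> decides summability.\<close>
      have bound: "norm (r i) \<le> \<bar>C\<bar> * (1 / 2) ^ i" if "k \<le> i" for i
      proof -
        let ?M = "Max {hnorm (S j (e i)) | j. j \<le> k}"
        have "0 \<le> hnorm (S 0 (e i))" by simp
        also have "\<dots> \<le> ?M" unfolding img by (rule Max_ge) auto
        finally have M: "0 \<le> ?M" .
        have "?M \<le> s i" unfolding s_def img using that by (intro Max_mono) auto
        have "hnorm (A (e i)) \<le> C * ?M" using kC e_in by blast
        also have "\<dots> \<le> \<bar>C\<bar> * ?M" using M by (simp add: mult_right_mono)
        also have "\<dots> \<le> \<bar>C\<bar> * s i" using \<open>?M \<le> s i\<close> by (simp add: mult_left_mono)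
        finally have "r i \<le> cmod (c i) * (\<bar>C\<bar> * s i)" unfolding r_def by (simp add: mult_left_mono)
        also have "\<dots> = \<bar>C\<bar> * (cmod (c i) * s i)" by simp
        also have "\<dots> \<le> \<bar>C\<bar> * (1 / 2) ^ i" by (intro mult_left_mono c) simp
        finally show ?thesis by (simp add: r_def)
      qed
      have "summable r"
        by (rule summable_comparison_test'[OF _ bound]) (auto intro!: summable_mult summable_geometric)
      then obtain N where N: "\<And>m n. N \<le> m \<Longrightarrow> norm (sum r {m..<n}) < \<epsilon>"
        using \<open>0 < \<epsilon>\<close> unfolding summable_Cauchy by blast
      have le: "hnorm (A (X n - X m)) < \<epsilon>" if mn: "N \<le> m" "m \<le> n" for m n
      proof -
        have "X n - X m = (\<Sum>i\<in>{m..<n}. c i *\<^sub>C e i)"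
          using sum_diff_nat_ivl[of 0 m n "\<lambda>i. c i *\<^sub>C e i"] mn by (simp add: X_def atLeast0LessThan)
        then have "hnorm (A (X n - X m)) = hnorm (\<Sum>i\<in>{m..<n}. c i *\<^sub>C A (e i))"
          using clinear_on_sum[OF lin, of "{m..<n}" e c] e_in by simp
        also have "\<dots> \<le> sum r {m..<n}"
          using hnorm_sum[of "\<lambda>i. c i *\<^sub>C A (e i)"] by (simp add: r_def hnorm_scaleC)
        also have "\<dots> < \<epsilon>" using N[OF mn(1), of n] by simp
        finally show ?thesis .
      qed
      have sym: "hnorm (A (X m - X n)) = hnorm (A (X n - X m))" for m n
      proof -
        have "A ((-1) *\<^sub>C (X n - X m)) = (-1) *\<^sub>C A (X n - X m)"
          using lin X_in unfolding clinear_on_def by (meson diff_in)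
        then have "A (X m - X n) = - A (X n - X m)" by (simp add: scaleC_one)
        then show ?thesis by simp
      qed
      have "hnorm (A (X m - X n)) < \<epsilon>" if "N \<le> m" "N \<le> n" for m n
        using le[of m n] le[of n m] sym[of m n] that by (cases "m \<le> n") auto
      then show ?thesis by blast
    qed
    have "graph_complete D" using F by (simp add: graph_F_space_def)
    note this[unfolded graph_complete_def, THEN spec[of _ X]]
    with X_in Cauchy obtain x where x: "x \<in> D"
      and conv: "\<And>A. Lplus D A \<Longrightarrow> (\<lambda>n. hnorm (A (X n - x))) \<longlonglongrightarrow> 0"
      by blast
    \<comment> \<open>The identity belongs to \<open>Lplus D\<close>, so graph convergence includes
      norm convergence and the coefficients pass to the limit.\<close>
    have lim: "(\<lambda>n. hnorm (X n - x)) \<longlonglongrightarrow> 0" using conv[OF Lplus_ident] .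
    have "cinner (e i) x = c i" for i
    proof -
      have "cmod (cinner (e i) (X n) - cinner (e i) x) \<le> hnorm (X n - x)" for n
        using cinner_Cauchy_Schwarz[of "e i" "X n - x"] orthonormal_hnorm[OF e, of i]
        by (simp add: cinner_diff_right)
      then have "(\<lambda>n. cinner (e i) (X n) - cinner (e i) x) \<longlonglongrightarrow> 0"
        by (intro Lim_null_comparison[OF _ lim]) simp
      then have "(\<lambda>n. cinner (e i) (X n)) \<longlonglongrightarrow> cinner (e i) x"
        by (simp add: LIM_zero_iff)
      moreover have "cinner (e i) (X n) = c i" if "i < n" for n
      proof -
        have "cinner (e i) (e j) = (if i = j then 1 else 0)" for j
          using e unfolding orthonormal_seq_def by blast
        then have "cinner (e i) (X n) = (\<Sum>j<n. c j * (if i = j then 1 else 0))"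
          by (simp only: X_def cinner_sum_right cinner_scaleC_right)
        then show ?thesis using that by (simp add: if_distrib cong: if_cong)
      qed
      then have "(\<lambda>n. cinner (e i) (X n)) \<longlonglongrightarrow> c i"
        \<comment> \<open>From \<open>Suc i\<close> on the partial sum contains the term with index
          \<open>i\<close>.\<close>
        by (intro tendsto_eventually) (auto simp: eventually_sequentially intro!: exI[of _ "Suc i"])
      ultimately show ?thesis using LIMSEQ_unique by blast
    qed
    with x show ?thesis by blast
  qed
  with s_nonneg show ?thesis by blast
qed

text \<open>The coefficients are chosen small enough to be those of one \<open>x\<close>, while
  Cauchy-Schwarz turns their large twists into arbitrarily large lower bounds for
  \<open>hnorm (A x)\<close>.\<close>

lemma (in inner_subspace) bounded_scalar_twist:
  assumes F: "graph_F_space D" and e: "orthonormal_seq e" and e_in: "\<And>i. e i \<in> D"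
    and pair: "\<And>x f. x \<in> D \<Longrightarrow> f \<in> D \<Longrightarrow> cinner (B f :: 'a) (A x) = \<tau> (cinner f x)"
  shows "\<exists>\<delta>>0. \<exists>M. \<forall>c. cmod c < \<delta> \<longrightarrow> cmod (\<tau> c) \<le> M"
proof (rule ccontr)
  assume "\<not> ?thesis"
  then have unbounded: "\<exists>c. cmod c < \<delta> \<and> M < cmod (\<tau> c)" if "0 < \<delta>" for \<delta> M
    using that by (meson not_less)
  obtain s where s: "\<And>i. 0 \<le> s i"
    and series: "\<And>c. (\<And>i. cmod (c i) * s i \<le> (1 / 2) ^ i) \<Longrightarrow> \<exists>x\<in>D. \<forall>i. cinner (e i) x = c i"
    using orthonormal_series[OF F e e_in] by metis
  \<comment> \<open>The \<open>1 + s i\<close> avoids division by zero and dominates the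
    \<open>s i\<close> of the decay condition; the \<open>+ 1\<close> in the lower bound keeps the
    factor cancelled below positive even if \<open>B (e i)\<close> vanishes.\<close>
  have "\<exists>c. cmod c < (1 / 2) ^ i / (1 + s i) \<and> real i * (hnorm (B (e i)) + 1) < cmod (\<tau> c)" for i
    using s[of i] by (intro unbounded) simp
  then obtain c where c: "\<And>i. cmod (c i) < (1 / 2) ^ i / (1 + s i)"
    and big: "\<And>i. real i * (hnorm (B (e i)) + 1) < cmod (\<tau> (c i))"
    by metis
  have "cmod (c i) * s i \<le> (1 / 2) ^ i" for i
  proof -
    have "cmod (c i) * s i \<le> cmod (c i) * (1 + s i)" by (simp add: mult_left_mono)
    also have "\<dots> \<le> (1 / 2) ^ i" using c[of i] s[of i] by (simp add: pos_less_divide_eq)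
    finally show ?thesis .
  qed
  then obtain x where x: "x \<in> D" "\<And>i. cinner (e i) x = c i" using series by blast
  have "real i < hnorm (A x)" for i
  proof -
    have "cmod (\<tau> (c i)) \<le> hnorm (B (e i)) * hnorm (A x)"
      using cinner_Cauchy_Schwarz[of "B (e i)" "A x"] pair[OF x(1) e_in] x by simp
    also have "\<dots> \<le> (hnorm (B (e i)) + 1) * hnorm (A x)" by (simp add: mult_right_mono)
    finally have "(hnorm (B (e i)) + 1) * real i < (hnorm (B (e i)) + 1) * hnorm (A x)"
      using big[of i] by (simp add: mult.commute)
    then show ?thesis by (rule mult_left_less_imp_less) (simp add: add_nonneg_nonneg)
  qed
  then show False using reals_Archimedean2[of "hnorm (A x)"] by (meson less_asym)
qed

text \<open>Gram-Schmidt inside \<open>D\<close>. If it stopped after \<open>n\<close> steps,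
  \<open>D\<close> would lie in the span of \<open>e 0, ..., e (n - 1)\<close>, and by density so
  would the whole space, contrary to infinite dimension.\<close>

lemma (in inner_subspace) orthonormal_seq_exists:
  assumes inf: "infinite_dimensional TYPE('a)" and dense: "dense_subspace D"
  shows "\<exists>e. orthonormal_seq e \<and> (\<forall>i. e i \<in> D)"
proof -
  let ?P = "\<lambda>(e::nat \<Rightarrow> 'a) n v. v \<in> D \<and> cinner v v = 1 \<and> (\<forall>i<n. cinner (e i) v = 0)"
  have step: "\<exists>v. ?P e n v" if prev: "\<And>i. i < n \<Longrightarrow> ?P e i (e i)" for e n
  proof (rule ccontr)
    assume no: "\<not> ?thesis"
    have orth: "cinner (e i) (e j) = (if i = j then 1 else 0)" if ij: "i < n" "j < n" for i j
      using prev[of i] prev[of j] ij cinner_conj_sym[of "e i" "e j"]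
      by (cases i j rule: linorder_cases) auto
    define p where "p v = (\<Sum>i<n. cinner (e i) v *\<^sub>C e i)" for v
    have perp: "cinner (e i) (v - p v) = 0" if "i < n" for i v
      using that by (simp add: p_def cinner_simps cinner_sum_right orth if_distrib cong: if_cong)
    have D_eq: "p v = v" if v: "v \<in> D" for v
    proof (rule ccontr)
      assume "p v \<noteq> v"
      define w where "w = v - p v"
      have w: "w \<noteq> 0" "w \<in> D"
        using \<open>p v \<noteq> v\<close> v prev unfolding w_def p_def by (auto intro!: diff_in sum_in scale_in)
      \<comment> \<open>A normalised nonzero residual would be an admissible next vector.\<close>
      have "?P e n ((1 / complex_of_real (hnorm w)) *\<^sub>C w)"
        using w perp[of _ v] cinner_self[of w]
        by (auto simp: cinner_simps power2_eq_square simp flip: w_def)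
      with no show False by blast
    qed
    have "p h = h" for h
    proof (rule ccontr)
      assume "p h \<noteq> h"
      define w where "w = h - p h"
      have w: "0 < hnorm w" using \<open>p h \<noteq> h\<close> by (simp add: w_def less_le)
      \<comment> \<open>The residual \<open>w\<close> is orthogonal to every \<open>p v\<close>,
        hence to \<open>D\<close>; an approximant from \<open>D\<close> closer to \<open>w\<close>
        than \<open>hnorm w\<close> then contradicts Cauchy-Schwarz.\<close>
      have "cinner w (p v) = 0" for v
      proof -
        have "cinner w (e i) = 0" if "i < n" for i
          using perp[OF that, of h] cinner_conj_sym[of w "e i"] by (simp add: w_def)
        then show ?thesis by (simp add: p_def cinner_sum_right cinner_scaleC_right)
      qed
      then have wD: "cinner w v = 0" if "v \<in> D" for v using D_eq[OF that] by metis
      obtain y where y: "y \<in> D" "hnorm (w - y) < hnorm w"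
        using dense w unfolding dense_subspace_def by blast
      have "(hnorm w)\<^sup>2 = cmod (cinner w (w - y))"
        using wD[OF y(1)] by (simp add: cinner_diff_right cinner_self norm_power)
      also have "\<dots> \<le> hnorm w * hnorm (w - y)" by (rule cinner_Cauchy_Schwarz)
      also have "\<dots> < hnorm w * hnorm w" using y w by simp
      finally show False by (simp add: power2_eq_square)
    qed
    then have "h \<in> cspan (e ` {..<n})" for h
      unfolding cspan_def
      by (auto intro!: exI[of _ "map (\<lambda>i. (cinner (e i) h, e i)) [0..<n]"]
          simp: p_def comp_def interv_sum_list_conv_sum_set_nat atLeast0LessThan)
    then have "cspan (e ` {..<n}) = UNIV" by blast
    with inf show False unfolding infinite_dimensional_def by blast
  qed
  have "\<exists>e. \<forall>n. ?P e n (e n)"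
    by (rule dependent_wellorder_choice) (use step in auto)
  then obtain e where e: "\<forall>n. ?P e n (e n)" ..
  have "cinner (e i) (e j) = (if i = j then 1 else 0)" for i j
    using e[rule_format, of i] e[rule_format, of j] cinner_conj_sym[of "e i" "e j"]
    by (cases i j rule: linorder_cases) simp_all
  with e show ?thesis unfolding orthonormal_seq_def by blast
qed

text \<open>Two orthonormal vectors cannot both be multiples of \<open>a\<close>.\<close>

lemma not_line_of_orthonormal:
  assumes "orthonormal_seq e"
  shows "\<exists>i. \<forall>k. e i \<noteq> k *\<^sub>C a"
proof (rule ccontr)
  assume "\<not> ?thesis"
  then obtain k l where kl: "e 0 = k *\<^sub>C a" "e 1 = l *\<^sub>C a" by metis
  have "cinner (e 0) (e 0) = 1" "cinner (e 1) (e 1) = 1" "cinner (e 0) (e 1) = 0"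
    using assms by (simp_all add: orthonormal_seq_def)
  then show False unfolding kl by (auto simp: cinner_simps)
qed

section \<open>Similarity\<close>

text \<open>Beyond the factorisation, surjectivity of \<open>\<Phi>\<close> is used twice: to show
  that \<open>A\<close> maps onto \<open>D\<close>, and to construct the adjoint of a linear
  \<open>A\<close>.\<close>

theorem (in proj_preserver) similarity:
  assumes RR: "\<forall>f\<in>D. right_to_right \<Phi> f" and RL: "\<forall>x\<in>D. right_to_left (\<Phi> \<circ> radj) x"
    and F: "graph_F_space D" and e: "orthonormal_seq e" and e_in: "\<And>i. e i \<in> D"
  shows "\<exists>A. bij_betw A D D \<and> (clinear_on D A \<or> antilinear_on D A) \<and>
    (\<forall>T\<in>finrank D. \<forall>x\<in>D. \<Phi> T x = A (T (inv_into D A x))) \<and> (clinear_on D A \<longrightarrow> Lplus D A)"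
proof -
  obtain A B \<tau> where A_in: "\<And>x. x \<in> D \<Longrightarrow> A x \<in> D" and B_in: "\<And>f. f \<in> D \<Longrightarrow> B f \<in> D"
    and A_add: "\<And>x y. x \<in> D \<Longrightarrow> y \<in> D \<Longrightarrow> A (x + y) = A x + A y"
    and A_scale: "\<And>c x. x \<in> D \<Longrightarrow> A (c *\<^sub>C x) = \<tau> c *\<^sub>C A x"
    and A_nz: "\<And>x. x \<in> D \<Longrightarrow> x \<noteq> 0 \<Longrightarrow> A x \<noteq> 0"
    and pair: "\<And>x f. x \<in> D \<Longrightarrow> f \<in> D \<Longrightarrow> cinner (B f) (A x) = \<tau> (cinner f x)"
    and fac: "\<And>x f. x \<in> D \<Longrightarrow> f \<in> D \<Longrightarrow> \<Phi> (tensor D x f) = tensor D (A x) (B f)"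
    using factorization[OF RR RL] by blast
  have twine: "\<Phi> T (A u) = A (T u)" if "T \<in> finrank D" "u \<in> D" for T u
    using intertwine[of A \<tau> B T u] A_in A_add A_scale fac pair that by blast
  have A_eq: "x = y" if xy: "x \<in> D" "y \<in> D" "A x = A y" for x y
  proof -
    have "A x = A y + A (x - y)" using A_add[of y "x - y"] xy by simp
    then show ?thesis using A_nz[of "x - y"] xy by auto
  qed
  define u where "u = e 0"
  have u: "u \<in> D" "cinner u u = 1" "u \<noteq> 0"
    using e e_in orthonormal_hnorm[OF e, of 0] unfolding u_def orthonormal_seq_def by auto
  \<comment> \<open>For \<open>T\<close> with image \<open>y \<otimes> g\<close>, where
    \<open>g\<close> pairs to 1 with \<open>A u\<close>, intertwining gives
    \<open>A (T u) = y\<close>.\<close>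
  have onto_D: "\<exists>x\<in>D. A x = y" if y: "y \<in> D" for y
  proof -
    obtain g where g: "g \<in> D" "cinner g (A u) = 1" using pairing_one' A_in A_nz u by blast
    obtain T where T: "T \<in> finrank D" "\<Phi> T = tensor D y g"
      using onto tensor_finrank[OF y g(1)] by (metis imageE)
    have "A (T u) = y" using twine[OF T(1) u(1)] g A_in u by (simp add: T tensor_apply scaleC_one)
    with T show ?thesis by auto
  qed
  have bij: "bij_betw A D D"
    unfolding bij_betw_def inj_on_def using A_eq A_in onto_D by blast
  \<comment> \<open>Scalar identities for \<open>\<tau>\<close> are read off from \<open>A\<close>
    at the nonzero vector \<open>A u\<close>.\<close>
  have tau_eq: "s = t" if "s *\<^sub>C A u = t *\<^sub>C A u" for s t
    using that A_nz u by simp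
  have "\<tau> (a + b) *\<^sub>C A u = (\<tau> a + \<tau> b) *\<^sub>C A u" for a b
    using A_scale[of u "a + b"] A_scale[of u a] A_scale[of u b] A_add[of "a *\<^sub>C u" "b *\<^sub>C u"] u
    by (simp add: cvec.scale_left_distrib)
  then have tau_add: "\<tau> (a + b) = \<tau> a + \<tau> b" for a b by (rule tau_eq)
  have "\<tau> (a * b) *\<^sub>C A u = (\<tau> a * \<tau> b) *\<^sub>C A u" for a b
    using A_scale[of u "a * b"] A_scale[of "b *\<^sub>C u" a] A_scale[of u b] u by simp
  then have tau_mult: "\<tau> (a * b) = \<tau> a * \<tau> b" for a b by (rule tau_eq)
  have "\<tau> 1 *\<^sub>C A u = 1 *\<^sub>C A u"
    using A_scale[of u 1] u by (simp add: scaleC_one)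
  then have tau_one: "\<tau> 1 = 1" by (rule tau_eq)
  obtain \<delta> M where "0 < \<delta>" "\<And>c. cmod c < \<delta> \<Longrightarrow> cmod (\<tau> c) \<le> M"
    using bounded_scalar_twist[of e B A \<tau>, OF F e e_in pair] by blast
  then have "\<tau> = id \<or> \<tau> = cnj"
    using ring_hom_bounded_near_zero[OF tau_add tau_mult tau_one] by blast
  then have lin: "clinear_on D A \<or> antilinear_on D A"
    unfolding clinear_on_def antilinear_on_def using A_add A_scale by auto
  have inv: "\<Phi> T x = A (T (inv_into D A x))" if "T \<in> finrank D" "x \<in> D" for T x
    using twine[of T "inv_into D A x"] that bij
    by (simp add: bij_betw_def f_inv_into_f inv_into_into)
  have "Lplus D A" if cl: "clinear_on D A"
    unfolding Lplus_def
  proof (intro conjI ballI)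
    show "A ` D \<subseteq> D" using A_in by blast
    fix w assume w: "w \<in> D"
    have tau_id: "\<tau> c = c" for c
      using cl A_scale[of u c] u tau_eq unfolding clinear_on_def by metis
    \<comment> \<open>With \<open>\<Phi> T = A u \<otimes> w\<close>, intertwining gives
      \<open>\<langle>w, A y\<rangle> A u = A (T y)\<close>. Pairing with \<open>B u\<close> and
      using \<open>\<tau> c = c\<close> leaves
      \<open>\<langle>w, A y\<rangle> = \<langle>u, T y\<rangle>\<close>, so \<open>radj T u\<close>
      is the value at \<open>w\<close> of the adjoint of \<open>A\<close>.\<close>
    obtain T where T: "T \<in> finrank D" "\<Phi> T = tensor D (A u) w"
      using onto tensor_finrank[OF A_in[OF u(1)] w] by (metis imageE)
    have "cinner (radj T u) y = cinner w (A y)" if y: "y \<in> D" for y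
    proof -
      have "cinner w (A y) *\<^sub>C A u = A (T y)"
        using twine[OF T(1) y] A_in y by (simp add: T tensor_apply)
      then have "cinner w (A y) * cinner (B u) (A u) = cinner (B u) (A (T y))"
        by (metis cinner_scaleC_right)
      then have "cinner w (A y) = cinner u (T y)"
        using T u y by (simp add: pair tau_id)
      then show ?thesis using T u y by (simp add: cinner_radj)
    qed
    then show "\<exists>z\<in>D. \<forall>y\<in>D. cinner z y = cinner w (A y)"
      using T by (intro bexI[of _ "radj T u"]) auto
  qed (use cl in auto)
  with bij lin inv show ?thesis by blast
qed

theorem theorem1p2:
  fixes D :: "'a::chilbert set"
    and \<Phi> :: "('a \<Rightarrow> 'a) \<Rightarrow> ('a \<Rightarrow> 'a)"
  assumes "infinite_dimensional TYPE('a)"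
    and "dense_subspace D"
    and "graph_F_space D"
    and "\<Phi> ` finrank D = finrank D"
    and "\<forall>S\<in>finrank D. \<forall>T\<in>finrank D. \<Phi> (\<lambda>x. S x + T x) = (\<lambda>x. \<Phi> S x + \<Phi> T x)"
    and "\<forall>P. rank_one_proj D P \<longrightarrow> rank_one_proj D (\<Phi> P)"
    and "\<forall>P. rank_one_proj D P \<longrightarrow> (\<forall>c. \<exists>d. \<Phi> (opscale c P) = opscale d (\<Phi> P))"
  shows "(\<exists>A. bij_betw A D D \<and> (clinear_on D A \<or> antilinear_on D A) \<and>
            (\<forall>T\<in>finrank D. \<forall>x\<in>D. \<Phi> T x = A (T (inv_into D A x))) \<and>
            (clinear_on D A \<longrightarrow> Lplus D A))
       \<or> (\<exists>C. bij_betw C D D \<and> (clinear_on D C \<or> antilinear_on D C) \<and>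
            (\<forall>T\<in>finrank D. \<forall>x\<in>D. \<Phi> T x = C (adjp D T (inv_into D C x))) \<and>
            (clinear_on D C \<longrightarrow> Lplus D C))"
proof -
  interpret inner_subspace D
    using assms(2) by unfold_locales (auto simp: dense_subspace_def)
  obtain e :: "nat \<Rightarrow> 'a" where e: "orthonormal_seq e" "\<And>i. e i \<in> D"
    using orthonormal_seq_exists assms(1,2) by blast
  interpret proj_preserver D \<Phi>
  proof
    show "\<exists>b\<in>D. \<forall>k. b \<noteq> k *\<^sub>C a" for a
      using not_line_of_orthonormal[OF e(1)] e(2) by blast
  qed (use assms(4-7) in simp_all)
  interpret flip: proj_preserver D "\<Phi> \<circ> radj" by (rule proj_preserver_flip)
  show ?thesis
  \<comment> \<open>Only the two mixed combinations for \<open>\<Phi>\<close> and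
    \<open>\<Phi> \<circ> radj\<close> survive. \<open>right_to_right\<close> for
    \<open>\<Phi>\<close> gives the first alternative; otherwise \<open>\<Phi> \<circ> radj\<close>
    is in that position and gives the second.\<close>
  proof (cases "\<forall>f\<in>D. right_to_right \<Phi> f")
    case True
    then have "\<forall>x\<in>D. right_to_left (\<Phi> \<circ> radj) x"
      using flip.right_uniform not_both_right_to_right by blast
    from similarity[OF True this assms(3) e] show ?thesis by blast
  next
    case False
    then have RL: "\<forall>f\<in>D. right_to_left \<Phi> f"
      using right_uniform by blast
    then have RR: "\<forall>x\<in>D. right_to_right (\<Phi> \<circ> radj) x"
      using flip.right_uniform not_both_right_to_left by blast
    \<comment> \<open>On rank-one operators \<open>radj\<close> is an involution, so this is
      \<open>RL\<close> again.\<close>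
    have "\<forall>x\<in>D. right_to_left (\<Phi> \<circ> radj \<circ> radj) x"
      using RL unfolding right_to_left_def by simp
    from flip.similarity[OF RR this assms(3) e] obtain C
      where C: "bij_betw C D D" "clinear_on D C \<or> antilinear_on D C" "clinear_on D C \<longrightarrow> Lplus D C"
        and C_eq: "\<forall>T\<in>finrank D. \<forall>x\<in>D. (\<Phi> \<circ> radj) T x = C (T (inv_into D C x))"
      by blast
    have "\<Phi> T x = C (adjp D T (inv_into D C x))" if "T \<in> finrank D" "x \<in> D" for T x
    proof -
      have "inv_into D C x \<in> D" using C(1) that by (metis bij_betw_def inv_into_into)
      then have "radj T (inv_into D C x) = adjp D T (inv_into D C x)" by (simp add: radj_def)
      then show ?thesis
        using C_eq[rule_format, of "radj T" x] that by simp
    qed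
    with C show ?thesis by blast
  qed
qed

end
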